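(* Let $q\in\mathbb{C}\setminus\{0\}$ be not a root of $1$. Suppose that $\pi$ is a $U_q(\mathfrak{sl}_2)$-symmetry on $\operatorname{Pol}(\mathbb{D})_q$ which does not belong to the $(0)$-series. Then there exists a unique non-zero integer $n$ such that for all $k\in\mathbb{Z}$ $$\pi(\mathsf{e})\mathcal{A}_k\subset\mathcal{A}_{k+n},\qquad \pi(\mathsf{f})\mathcal{A}_k\subset\mathcal{A}_{k-n}.$$
   Context: The ground field is $\mathbb{C}$. The quantum disc $\operatorname{Pol}(\mathbb{D})_q$ is the unital $\mathbb{C}$-algebra generated by $z,z^*$ subject to the single relation $zz^*=q^2z^*z+1-q^2$; it is considered as an algebra without involution, so $z^*$ is just a symbol for a second generator. It is graded, $\operatorname{Pol}(\mathbb{D})_q=\bigoplus_{k\in\mathbb{Z}}\mathcal{A}_k$, where $\mathcal{A}_k$ is the linear span of $\{z^i(z^* )^j : i-j=k\}$. $U_q(\mathfrak{sl}_2)$ is the unital associative algebra generated by $\mathsf{k},\mathsf{k}^{-1},\mathsf{e},\mathsf{f}$ subject to $\mathsf{k}^{-1}\mathsf{k}=\mathsf{k}\mathsf{k}^{-1}=\mathbf{1}$, $\mathsf{ke}=q^2\mathsf{ek}$, $\mathsf{kf}=q^{-2}\mathsf{fk}$, $\mathsf{ef}-\mathsf{fe}=\frac{\mathsf{k}-\mathsf{k}^{-1}}{q-q^{-1}}$, with Hopf algebra structure $\Delta(\mathsf{k})=\mathsf{k}\otimes\mathsf{k}$, $\Delta(\mathsf{e})=\mathbf{1}\otimes\mathsf{e}+\mathsf{e}\otimes\mathsf{k}$,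 $\Delta(\mathsf{f})=\mathsf{f}\otimes\mathbf{1}+\mathsf{k}^{-1}\otimes\mathsf{f}$, $\mathsf{S}(\mathsf{k})=\mathsf{k}^{-1}$, $\mathsf{S}(\mathsf{e})=-\mathsf{ek}^{-1}$, $\mathsf{S}(\mathsf{f})=-\mathsf{kf}$, $\varepsilon(\mathsf{k})=1$, $\varepsilon(\mathsf{e})=\varepsilon(\mathsf{f})=0$. For a Hopf algebra $H$ and a unital algebra $A$, an $H$-symmetry on $A$ is a homomorphism of algebras $\pi:H\to\operatorname{End}_{\mathbb{C}}A$ such that $\pi(h)(ab)=\sum_{(h)}\pi(h_{(1)})(a)\,\pi(h_{(2)})(b)$ and $\pi(h)(\mathbf{1})=\varepsilon(h)\mathbf{1}$ for all $h\in H$, $a,b\in A$. For every $U_q(\mathfrak{sl}_2)$-symmetry $\pi$ on $\operatorname{Pol}(\mathbb{D})_q$ there is a constant $\alpha\in\mathbb{C}\setminus\{0\}$ (the weight constant) with $\pi(\mathsf{k})(z)=\alpha z$, $\pi(\mathsf{k})(z^* )=\alpha^{-1}z^*$ (known, since by Alev and Chamarie all automorphisms of $\operatorname{Pol}(\mathbb{D})_q$ are of the form $z\mapsto\alpha z$, $z^*\mapsto\alpha^{-1}z^*$). The $(0)$-series is the collection of all symmetries $\pi$ satisfying the equivalent conditions: $\alpha\in\{-1,1\}$; $\pi(\mathsf{e})=0$; $\pi(\mathsf{f})=0$; $\pi(\mathsf{e})=\pi(\mathsf{f})=0$. *)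

theory Defs
  imports
    Complex_Main
    "HOL-Library.Poly_Mapping"
    "HOL-Library.Product_Plus"
    "HOL-Algebra.QuotRing"
    "HOL-Algebra.Module"
begin

section \<open>Complex algebras given by generators and relations\<close>

text \<open>
  A (not necessarily commutative) complex algebra is a record of type
  \<open>(complex, 'a) module\<close>: a ring together with a scalar multiplication. The locale
  \<open>algebra\<close> of HOL-Algebra only covers commutative algebras and is not used.
\<close>

text \<open>Lists are words, i.e. the free monoid, so that \<^typ>\<open>'g list \<Rightarrow>\<^sub>0 complex\<close> with its
  convolution product is the free algebra on the generators \<^typ>\<open>'g\<close>.\<close>

instantiation list :: (type) monoid_add
begin
definition zero_list :: "'a list" where "zero_list = []"
definition plus_list :: "'a list \<Rightarrow> 'a list \<Rightarrow> 'a list" where "plus_list = (@)"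
instance by standard (simp_all add: zero_list_def plus_list_def)
end

definition const :: "complex \<Rightarrow> ('m::monoid_add \<Rightarrow>\<^sub>0 complex)" where
  "const c = Poly_Mapping.single 0 c"

definition var :: "'g \<Rightarrow> ('g list \<Rightarrow>\<^sub>0 complex)" where
  "var g = Poly_Mapping.single [g] 1"

definition free_algebra :: "(complex, 'g list \<Rightarrow>\<^sub>0 complex) module" where
  "free_algebra = \<lparr>carrier = UNIV, mult = (*), one = 1, zero = 0, add = (+),
     smult = (\<lambda>c x. const c * x)\<rparr>"

definition quotient_algebra :: "(complex, 'a) module \<Rightarrow> 'a set \<Rightarrow> (complex, 'a set) module" where
  "quotient_algebra A I = ring.extend (A Quot I)
     (module.fields (\<lambda>c X. \<Union>x\<in>X. I +>\<^bsub>A\<^esub> (c \<odot>\<^bsub>A\<^esub> x)))"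

definition presented_algebra ::
    "('g list \<Rightarrow>\<^sub>0 complex) set \<Rightarrow> (complex, ('g list \<Rightarrow>\<^sub>0 complex) set) module" where
  "presented_algebra R = quotient_algebra free_algebra (Idl\<^bsub>free_algebra\<^esub> R)"

definition residue_class ::
    "('g list \<Rightarrow>\<^sub>0 complex) set \<Rightarrow> ('g list \<Rightarrow>\<^sub>0 complex) \<Rightarrow> ('g list \<Rightarrow>\<^sub>0 complex) set" where
  "residue_class R x = (Idl\<^bsub>free_algebra\<^esub> R) +>\<^bsub>free_algebra\<^esub> x"

text \<open>The unital algebra homomorphism from the free algebra that sends each generator \<open>g\<close> to
  \<open>\<phi> g\<close>; the map \<open>\<iota>\<close> embeds the scalars into the target.\<close>

definition free_lift ::
    "(complex \<Rightarrow> 'b) \<Rightarrow> ('g \<Rightarrow> 'b) \<Rightarrow> ('g list \<Rightarrow>\<^sub>0 complex) \<Rightarrow> 'b::semiring_1" where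
  "free_lift \<iota> \<phi> x =
     (\<Sum>w\<in>Poly_Mapping.keys x. \<iota> (Poly_Mapping.lookup x w) * prod_list (map \<phi> w))"

inductive_set linear_span :: "(complex, 'a) module \<Rightarrow> 'a set \<Rightarrow> 'a set"
  for A :: "(complex, 'a) module" and S :: "'a set" where
    zero: "\<zero>\<^bsub>A\<^esub> \<in> linear_span A S"
  | base: "x \<in> S \<Longrightarrow> x \<in> linear_span A S"
  | add: "x \<in> linear_span A S \<Longrightarrow> y \<in> linear_span A S \<Longrightarrow> x \<oplus>\<^bsub>A\<^esub> y \<in> linear_span A S"
  | smult: "x \<in> linear_span A S \<Longrightarrow> c \<odot>\<^bsub>A\<^esub> x \<in> linear_span A S"

text \<open>The algebra of linear endomorphisms. Endomorphisms are \<^const>\<open>undefined\<close> outside the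
  carrier, so that equality of functions is equality of endomorphisms.\<close>

definition End_algebra :: "(complex, 'a) module \<Rightarrow> (complex, 'a \<Rightarrow> 'a) module" where
  "End_algebra A =
    \<lparr>carrier = {f \<in> carrier A \<rightarrow>\<^sub>E carrier A.
        (\<forall>x\<in>carrier A. \<forall>y\<in>carrier A. f (x \<oplus>\<^bsub>A\<^esub> y) = f x \<oplus>\<^bsub>A\<^esub> f y) \<and>
        (\<forall>c. \<forall>x\<in>carrier A. f (c \<odot>\<^bsub>A\<^esub> x) = c \<odot>\<^bsub>A\<^esub> f x)},
     mult = (\<lambda>f g. compose (carrier A) f g),
     one = (\<lambda>x\<in>carrier A. x),
     zero = (\<lambda>x\<in>carrier A. \<zero>\<^bsub>A\<^esub>),
     add = (\<lambda>f g. \<lambda>x\<in>carrier A. f x \<oplus>\<^bsub>A\<^esub> g x),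
     smult = (\<lambda>c f. \<lambda>x\<in>carrier A. c \<odot>\<^bsub>A\<^esub> f x)\<rparr>"

definition algebra_hom ::
    "(complex, 'a, 'm) module_scheme \<Rightarrow> (complex, 'b, 'n) module_scheme \<Rightarrow> ('a \<Rightarrow> 'b) set" where
  "algebra_hom A B = {h \<in> ring_hom A B.
     \<forall>c. \<forall>x\<in>carrier A. h (c \<odot>\<^bsub>A\<^esub> x) = c \<odot>\<^bsub>B\<^esub> h x}"


section \<open>Hopf algebras and symmetries\<close>

text \<open>
  An element of \<open>H \<otimes> H\<close> is the class, modulo the bilinearity relations, of a formal
  linear combination of pairs of elements of \<open>H\<close>.
\<close>

definition bilinearity_relations ::
    "(complex, 'h, 'm) module_scheme \<Rightarrow> ('h \<times> 'h \<Rightarrow>\<^sub>0 complex) set" where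
  "bilinearity_relations H =
     (let s = (\<lambda>x y. Poly_Mapping.single (x, y) (1::complex));
          sc = (\<lambda>c x y. Poly_Mapping.single (x, y) (c::complex))
      in {s (x \<oplus>\<^bsub>H\<^esub> x') y - s x y - s x' y | x x' y.
            x \<in> carrier H \<and> x' \<in> carrier H \<and> y \<in> carrier H} \<union>
         {s x (y \<oplus>\<^bsub>H\<^esub> y') - s x y - s x y' | x y y'.
            x \<in> carrier H \<and> y \<in> carrier H \<and> y' \<in> carrier H} \<union>
         {s (c \<odot>\<^bsub>H\<^esub> x) y - sc c x y | c x y. x \<in> carrier H \<and> y \<in> carrier H} \<union>
         {s x (c \<odot>\<^bsub>H\<^esub> y) - sc c x y | c x y. x \<in> carrier H \<and> y \<in> carrier H})"

definition tensor_class ::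
    "(complex, 'h, 'm) module_scheme \<Rightarrow> ('h \<times> 'h \<Rightarrow>\<^sub>0 complex) \<Rightarrow> ('h \<times> 'h \<Rightarrow>\<^sub>0 complex) set" where
  "tensor_class H t = {t'. Poly_Mapping.keys t' \<subseteq> carrier H \<times> carrier H \<and>
     t' - t \<in> Modules.module.span (\<lambda>c. Poly_Mapping.map ((*) c)) (bilinearity_relations H)}"

text \<open>The coproduct takes its values in \<open>H \<otimes> H\<close>, i.e. \<open>comult h\<close> is the set of all
  formal sums of pairs that represent the tensor \<open>\<Delta>(h)\<close>.\<close>

record 'h hopf = "(complex, 'h) module" +
  comult :: "'h \<Rightarrow> ('h \<times> 'h \<Rightarrow>\<^sub>0 complex) set"
  counit :: "'h \<Rightarrow> complex"
  antipode :: "'h \<Rightarrow> 'h"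

definition symmetries :: "'h hopf \<Rightarrow> (complex, 'a) module \<Rightarrow> ('h \<Rightarrow> 'a \<Rightarrow> 'a) set" where
  "symmetries H A = {\<pi> \<in> algebra_hom H (End_algebra A).
     (\<forall>h\<in>carrier H. \<forall>a\<in>carrier A. \<forall>b\<in>carrier A. \<forall>t\<in>comult H h.
        \<pi> h (a \<otimes>\<^bsub>A\<^esub> b) =
          (\<Oplus>\<^bsub>A\<^esub>p\<in>Poly_Mapping.keys t.
             Poly_Mapping.lookup t p \<odot>\<^bsub>A\<^esub> (\<pi> (fst p) a \<otimes>\<^bsub>A\<^esub> \<pi> (snd p) b))) \<and>
     (\<forall>h\<in>carrier H. \<pi> h \<one>\<^bsub>A\<^esub> = counit H h \<odot>\<^bsub>A\<^esub> \<one>\<^bsub>A\<^esub>)}"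


section \<open>The quantum disc\<close>

text \<open>The generator \<open>Zs\<close> stands for the symbol \<open>z*\<close>.\<close>

datatype disc_gen = Z | Zs

type_synonym disc = "(disc_gen list \<Rightarrow>\<^sub>0 complex) set"

definition disc_relations :: "complex \<Rightarrow> (disc_gen list \<Rightarrow>\<^sub>0 complex) set" where
  "disc_relations q =
     {var Z * var Zs - (const (q\<^sup>2) * var Zs * var Z + const (1 - q\<^sup>2))}"

definition qdisc :: "complex \<Rightarrow> (complex, disc) module" where
  "qdisc q = presented_algebra (disc_relations q)"

definition disc_z :: "complex \<Rightarrow> disc" where
  "disc_z q = residue_class (disc_relations q) (var Z)"

definition disc_zs :: "complex \<Rightarrow> disc" where
  "disc_zs q = residue_class (disc_relations q) (var Zs)"

definition disc_grade :: "complex \<Rightarrow> int \<Rightarrow> disc set" where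
  "disc_grade q k = linear_span (qdisc q)
     {disc_z q [^]\<^bsub>qdisc q\<^esub> i \<otimes>\<^bsub>qdisc q\<^esub> disc_zs q [^]\<^bsub>qdisc q\<^esub> j | i j :: nat.
        int i - int j = k}"


section \<open>The quantum universal enveloping algebra of sl2\<close>

text \<open>The generator \<open>Ki\<close> stands for the inverse of \<open>K\<close>.\<close>

datatype uq_gen = K | Ki | E | F

type_synonym uqsl2 = "(uq_gen list \<Rightarrow>\<^sub>0 complex) set"

definition uq_relations :: "complex \<Rightarrow> (uq_gen list \<Rightarrow>\<^sub>0 complex) set" where
  "uq_relations q =
     {var Ki * var K - 1,
      var K * var Ki - 1,
      var K * var E - const (q\<^sup>2) * var E * var K,
      var K * var F - const (inverse (q\<^sup>2)) * var F * var K,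
      var E * var F - var F * var E - const (1 / (q - inverse q)) * (var K - var Ki)}"

definition uq_algebra :: "complex \<Rightarrow> (complex, uqsl2) module" where
  "uq_algebra q = presented_algebra (uq_relations q)"

definition uq_k :: "complex \<Rightarrow> uqsl2" where
  "uq_k q = residue_class (uq_relations q) (var K)"

definition uq_e :: "complex \<Rightarrow> uqsl2" where
  "uq_e q = residue_class (uq_relations q) (var E)"

definition uq_f :: "complex \<Rightarrow> uqsl2" where
  "uq_f q = residue_class (uq_relations q) (var F)"

text \<open>
  The structure maps are algebra (anti-)homomorphisms prescribed on generators. They are first
  defined on the free algebra \<open>A\<close> on the generators and then passed to the quotient. Here
  \<open>A \<otimes> A\<close> is the monoid algebra of pairs of words, \<open>tens x y\<close> is the pure tensor of two
  elements of \<open>A\<close>, and \<open>uq_tensor q\<close> is the projection from \<open>A \<otimes> A\<close> to formal sums of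
  pairs of residue classes.
\<close>

definition tens :: "('g list \<Rightarrow>\<^sub>0 complex) \<Rightarrow> ('g list \<Rightarrow>\<^sub>0 complex) \<Rightarrow>
    ('g list \<times> 'g list \<Rightarrow>\<^sub>0 complex)" where
  "tens x y = (\<Sum>u\<in>Poly_Mapping.keys x. \<Sum>v\<in>Poly_Mapping.keys y.
     Poly_Mapping.single (u, v) (Poly_Mapping.lookup x u * Poly_Mapping.lookup y v))"

primrec free_comult :: "uq_gen \<Rightarrow> (uq_gen list \<times> uq_gen list \<Rightarrow>\<^sub>0 complex)" where
  "free_comult K = tens (var K) (var K)"
| "free_comult Ki = tens (var Ki) (var Ki)"
| "free_comult E = tens 1 (var E) + tens (var E) (var K)"
| "free_comult F = tens (var F) 1 + tens (var Ki) (var F)"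

primrec free_counit :: "uq_gen \<Rightarrow> complex" where
  "free_counit K = 1"
| "free_counit Ki = 1"
| "free_counit E = 0"
| "free_counit F = 0"

primrec free_antipode :: "uq_gen \<Rightarrow> (uq_gen list \<Rightarrow>\<^sub>0 complex)" where
  "free_antipode K = var Ki"
| "free_antipode Ki = var K"
| "free_antipode E = - (var E * var Ki)"
| "free_antipode F = - (var K * var F)"

definition uq_tensor :: "complex \<Rightarrow> (uq_gen list \<times> uq_gen list \<Rightarrow>\<^sub>0 complex) \<Rightarrow>
    (uqsl2 \<times> uqsl2 \<Rightarrow>\<^sub>0 complex)" where
  "uq_tensor q t = (\<Sum>(u, v)\<in>Poly_Mapping.keys t.
     Poly_Mapping.single
       (residue_class (uq_relations q) (Poly_Mapping.single u 1),
        residue_class (uq_relations q) (Poly_Mapping.single v 1))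
       (Poly_Mapping.lookup t (u, v)))"

definition uq :: "complex \<Rightarrow> uqsl2 hopf" where
  "uq q = module.extend (uq_algebra q) (hopf.fields
     (\<lambda>h. \<Union>x\<in>h. tensor_class (uq_algebra q) (uq_tensor q (free_lift const free_comult x)))
     (\<lambda>h. the_elem ((\<lambda>x. free_lift (\<lambda>c. c) free_counit x) ` h))
     (\<lambda>h. \<Union>x\<in>h. residue_class (uq_relations q)
        (\<Sum>w\<in>Poly_Mapping.keys x.
           const (Poly_Mapping.lookup x w) * prod_list (map free_antipode (rev w)))))"


section \<open>Symmetries of the quantum disc\<close>

abbreviation disc_symmetries :: "complex \<Rightarrow> (uqsl2 \<Rightarrow> disc \<Rightarrow> disc) set" where
  "disc_symmetries q \<equiv> symmetries (uq q) (qdisc q)"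

definition weight_constant ::
    "complex \<Rightarrow> (uqsl2 \<Rightarrow> disc \<Rightarrow> disc) \<Rightarrow> complex \<Rightarrow> bool" where
  "weight_constant q \<pi> \<alpha> \<longleftrightarrow> \<alpha> \<noteq> 0 \<and>
     \<pi> (uq_k q) (disc_z q) = \<alpha> \<odot>\<^bsub>qdisc q\<^esub> disc_z q \<and>
     \<pi> (uq_k q) (disc_zs q) = inverse \<alpha> \<odot>\<^bsub>qdisc q\<^esub> disc_zs q"

text \<open>For \<open>q\<close> not a root of unity, each of the conditions \<open>\<alpha> \<in> {-1, 1}\<close>,
  \<open>\<pi>(e) = 0\<close> and \<open>\<pi>(f) = 0\<close> already implies the others. The definition demands all of them,
  so that a symmetry outside the series is only known to violate one of them.\<close>

definition zero_series :: "complex \<Rightarrow> (uqsl2 \<Rightarrow> disc \<Rightarrow> disc) set" where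
  "zero_series q = {\<pi> \<in> disc_symmetries q.
     (\<exists>\<alpha>. weight_constant q \<pi> \<alpha> \<and> \<alpha> \<in> {-1, 1}) \<and>
     \<pi> (uq_e q) = \<zero>\<^bsub>End_algebra (qdisc q)\<^esub> \<and>
     \<pi> (uq_f q) = \<zero>\<^bsub>End_algebra (qdisc q)\<^esub>}"

end

theory Submission
  imports Defs "HOL-Computational_Algebra.Polynomial"
begin

text \<open>
  Work in the free algebra on \<open>z, z\<^sup>*\<close> modulo the defining relation, and put \<open>y = 1 - z z\<^sup>*\<close>. Then
  \<open>z y = q\<^sup>2 y z\<close> and \<open>z\<^sup>* y = q\<^sup>-\<^sup>2 y z\<^sup>*\<close>, so that the grading is the decomposition into eigenspaces
  of conjugation by \<open>y\<close>, and \<open>y\<close> generates the commutator ideal. An automorphism \<open>\<phi>\<close>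
  preserves this ideal, hence multiplies \<open>y\<close> by a unit, i.e. by a scalar. So \<open>\<phi>\<close> preserves
  the degree, and comparing degrees in \<open>y\<close> in \<open>\<phi>(z) \<phi>(z\<^sup>*) = 1 - \<phi>(y)\<close> gives \<open>\<phi>(z) = \<alpha> z\<close> and
  \<open>\<phi>(z\<^sup>*) = \<alpha>\<^sup>-\<^sup>1 z\<^sup>*\<close>.

  Hence \<open>\<pi>(k)\<close> acts on \<open>A\<^sub>j\<close> by \<open>\<alpha>\<^sup>j\<close>, and \<open>\<pi>(e)\<close> maps this eigenspace into the one for \<open>q\<^sup>2 \<alpha>\<^sup>j\<close>.
  If no power of \<open>\<alpha>\<close> equals \<open>q\<^sup>2\<close>, then \<open>\<pi>(e) = \<pi>(f) = 0\<close>, hence \<open>\<pi>(k) = \<pi>(k\<^sup>-\<^sup>1)\<close> and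
  \<open>\<alpha> = \<plusminus>1\<close>. If \<open>\<alpha>\<^sup>n = q\<^sup>2\<close>, then \<open>\<alpha>\<close> is not a root of unity, the eigenspaces of \<open>\<pi>(k)\<close> are exactly
  the \<open>A\<^sub>j\<close>, and \<open>n\<close> is the required shift.
\<close>

section \<open>Presented algebras\<close>

lemma ring_free_algebra: "ring (free_algebra :: (complex, 'g list \<Rightarrow>\<^sub>0 complex) module)"
proof (rule ringI)
  show "abelian_group (free_algebra :: (complex, 'g list \<Rightarrow>\<^sub>0 complex) module)"
  proof (rule abelian_groupI)
    fix x :: "'g list \<Rightarrow>\<^sub>0 complex"
    have "- x + x = 0" by simp
    then show "\<exists>y\<in>carrier free_algebra. y \<oplus>\<^bsub>free_algebra\<^esub> x = \<zero>\<^bsub>free_algebra\<^esub>"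
      unfolding free_algebra_def by (metis UNIV_I partial_object.select_convs(1) ring_record_simps(11,12))
  qed (auto simp: free_algebra_def ac_simps)
  show "Group.monoid (free_algebra :: (complex, 'g list \<Rightarrow>\<^sub>0 complex) module)"
    by (rule monoidI) (auto simp: free_algebra_def ac_simps)
qed (auto simp: free_algebra_def algebra_simps)

lemma ideal_relations: "ideal (Idl\<^bsub>free_algebra\<^esub> R) free_algebra"
  by (rule ring.genideal_ideal[OF ring_free_algebra]) (simp add: free_algebra_def)

lemma free_algebra_a_minus: "x \<ominus>\<^bsub>free_algebra\<^esub> y = x - (y :: 'g list \<Rightarrow>\<^sub>0 complex)"
proof -
  interpret ring "free_algebra :: (complex, 'g list \<Rightarrow>\<^sub>0 complex) module"
    by (rule ring_free_algebra)
  have "y \<oplus>\<^bsub>free_algebra\<^esub> (\<ominus>\<^bsub>free_algebra\<^esub> y) = \<zero>\<^bsub>free_algebra\<^esub>"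
    by (rule r_neg) (simp add: free_algebra_def)
  then show ?thesis
    by (simp add: free_algebra_def a_minus_def eq_neg_iff_add_eq_0 add.commute)
qed

lemma residue_class_eq_iff:
  "residue_class R x = residue_class R y \<longleftrightarrow> x - y \<in> Idl\<^bsub>free_algebra\<^esub> R"
proof -
  interpret ideal "Idl\<^bsub>free_algebra\<^esub> R" "free_algebra :: (complex, 'a list \<Rightarrow>\<^sub>0 complex) module"
    by (rule ideal_relations)
  show ?thesis
    unfolding residue_class_def free_algebra_a_minus[symmetric]
    using quotient_eq_iff_same_a_r_cos[OF ideal_axioms, of x y] by (auto simp: free_algebra_def)
qed

lemma residue_class_eqI: "x - y \<in> R \<Longrightarrow> residue_class R x = residue_class R y"
  unfolding residue_class_eq_iff
  using ring.genideal_self[OF ring_free_algebra, of R] by (auto simp: free_algebra_def)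

lemma residue_class_self: "x \<in> residue_class R x"
proof -
  interpret ideal "Idl\<^bsub>free_algebra\<^esub> R" "free_algebra :: (complex, 'a list \<Rightarrow>\<^sub>0 complex) module"
    by (rule ideal_relations)
  show ?thesis
    unfolding residue_class_def by (rule a_rcos_self) (simp add: free_algebra_def)
qed

lemma residue_class_memD:
  assumes "y \<in> residue_class R x"
  shows "residue_class R y = residue_class R x"
proof -
  interpret ideal "Idl\<^bsub>free_algebra\<^esub> R" "free_algebra :: (complex, 'a list \<Rightarrow>\<^sub>0 complex) module"
    by (rule ideal_relations)
  show ?thesis
    unfolding residue_class_def
    using a_repr_independence[OF assms[unfolded residue_class_def] _ a_subgroup]
    by (simp add: free_algebra_def)
qed

lemma carrier_presented_algebra: "carrier (presented_algebra R) = range (residue_class R)"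
  by (auto simp: presented_algebra_def quotient_algebra_def ring.defs FactRing_def
      A_RCOSETS_def' residue_class_def free_algebra_def)

lemma one_presented_algebra: "\<one>\<^bsub>presented_algebra R\<^esub> = residue_class R 1"
  by (simp add: presented_algebra_def quotient_algebra_def ring.defs FactRing_def
      residue_class_def) (simp add: free_algebra_def)

lemma zero_presented_algebra: "\<zero>\<^bsub>presented_algebra R\<^esub> = residue_class R 0"
proof -
  interpret ideal "Idl\<^bsub>free_algebra\<^esub> R" "free_algebra :: (complex, 'a list \<Rightarrow>\<^sub>0 complex) module"
    by (rule ideal_relations)
  have "Idl\<^bsub>free_algebra\<^esub> R +>\<^bsub>free_algebra\<^esub> \<zero>\<^bsub>free_algebra\<^esub> = Idl\<^bsub>free_algebra\<^esub> R"
    by (rule a_coset_add_zero) (simp add: free_algebra_def)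
  then show ?thesis
    by (simp add: presented_algebra_def quotient_algebra_def ring.defs FactRing_def
      residue_class_def) (simp add: free_algebra_def)
qed

lemma add_presented_algebra:
  "residue_class R x \<oplus>\<^bsub>presented_algebra R\<^esub> residue_class R y = residue_class R (x + y)"
proof -
  interpret ideal "Idl\<^bsub>free_algebra\<^esub> R" "free_algebra :: (complex, 'a list \<Rightarrow>\<^sub>0 complex) module"
    by (rule ideal_relations)
  show ?thesis
    using a_rcos_sum[of x y]
    by (simp add: presented_algebra_def quotient_algebra_def ring.defs FactRing_def
      residue_class_def) (simp add: free_algebra_def)
qed

lemma mult_presented_algebra:
  "residue_class R x \<otimes>\<^bsub>presented_algebra R\<^esub> residue_class R y = residue_class R (x * y)"
proof -
  interpret ideal "Idl\<^bsub>free_algebra\<^esub> R" "free_algebra :: (complex, 'a list \<Rightarrow>\<^sub>0 complex) module"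
    by (rule ideal_relations)
  show ?thesis
    using rcoset_mult_add[of x y]
    by (simp add: presented_algebra_def quotient_algebra_def ring.defs FactRing_def
      residue_class_def) (simp add: free_algebra_def)
qed

lemma residue_class_const_mult:
  assumes "residue_class R x = residue_class R y"
  shows "residue_class R (const c * x) = residue_class R (const c * y)"
  by (metis assms mult_presented_algebra)

text \<open>The defining union runs over a nonempty coset, and all its members coincide because
  multiplication by \<open>const c\<close> is compatible with classes.\<close>

lemma smult_presented_algebra:
  "c \<odot>\<^bsub>presented_algebra R\<^esub> residue_class R x = residue_class R (const c * x)"
proof -
  have "c \<odot>\<^bsub>presented_algebra R\<^esub> residue_class R x =
      (\<Union>y\<in>residue_class R x. residue_class R (const c * y))"
    by (simp add: presented_algebra_def quotient_algebra_def ring.defs module.defs residue_class_def)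
      (simp add: free_algebra_def)
  also have "\<dots> = (\<Union>y\<in>residue_class R x. residue_class R (const c * x))"
    using residue_class_const_mult residue_class_memD by (metis (no_types, lifting) SUP_cong)
  also have "\<dots> = residue_class R (const c * x)"
    using residue_class_self[of x R] by auto
  finally show ?thesis .
qed

lemmas presented_algebra_simps =
  one_presented_algebra zero_presented_algebra add_presented_algebra mult_presented_algebra
  smult_presented_algebra

lemma residue_class_add:
  "residue_class R x = residue_class R x' \<Longrightarrow> residue_class R y = residue_class R y' \<Longrightarrow>
   residue_class R (x + y) = residue_class R (x' + y')"
  by (metis add_presented_algebra)

lemma residue_class_mult:
  "residue_class R x = residue_class R x' \<Longrightarrow> residue_class R y = residue_class R y' \<Longrightarrow>
   residue_class R (x * y) = residue_class R (x' * y')"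
  by (metis mult_presented_algebra)

lemma residue_class_diff:
  "residue_class R x = residue_class R x' \<Longrightarrow> residue_class R y = residue_class R y' \<Longrightarrow>
   residue_class R (x - y) = residue_class R (x' - y')"
  using residue_class_add[of R x x' "- y" "- y'"] residue_class_mult[OF refl, of R y y' "- 1"]
  by simp

lemma abelian_monoid_presented_algebra: "abelian_monoid (presented_algebra R)"
  by (rule abelian_monoidI)
    (auto simp: carrier_presented_algebra presented_algebra_simps ac_simps)

lemma pow_presented_algebra:
  "residue_class R x [^]\<^bsub>presented_algebra R\<^esub> (n::nat) = residue_class R (x ^ n)"
  by (induction n)
    (simp_all add: presented_algebra_simps nat_pow_def power_Suc2 del: power_Suc)

text \<open>This is how functions on representatives are shown to descend to the quotient:
  \<open>I\<close> is taken to be the set where the function vanishes, and only the defining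
  relations have to be checked.\<close>

lemma residue_class_ideal_minimal:
  assumes "ideal I free_algebra" and "R \<subseteq> I" and "residue_class R x = residue_class R y"
  shows "x - y \<in> I"
  using ring.genideal_minimal[OF ring_free_algebra assms(1,2)] assms(3)
  by (auto simp: residue_class_eq_iff)

lemma ideal_free_algebraI:
  fixes I :: "('g list \<Rightarrow>\<^sub>0 complex) set"
  assumes "0 \<in> I" and "\<And>x y. x \<in> I \<Longrightarrow> y \<in> I \<Longrightarrow> x + y \<in> I"
    and "\<And>x y. x \<in> I \<Longrightarrow> y * x \<in> I" and "\<And>x y. x \<in> I \<Longrightarrow> x * y \<in> I"
  shows "ideal I free_algebra"
proof (rule idealI[OF ring_free_algebra])
  have minus: "\<ominus>\<^bsub>free_algebra\<^esub> x = - x" for x :: "'g list \<Rightarrow>\<^sub>0 complex"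
  proof -
    interpret ring "free_algebra :: (complex, 'g list \<Rightarrow>\<^sub>0 complex) module"
      by (rule ring_free_algebra)
    have "x \<oplus>\<^bsub>free_algebra\<^esub> (\<ominus>\<^bsub>free_algebra\<^esub> x) = \<zero>\<^bsub>free_algebra\<^esub>"
      by (rule r_neg) (simp add: free_algebra_def)
    then show ?thesis
      by (simp add: free_algebra_def eq_neg_iff_add_eq_0 add.commute)
  qed
  have neg: "- x \<in> I" if "x \<in> I" for x
    using assms(3)[OF that, of "-1"] by simp
  show "subgroup I (add_monoid free_algebra)"
    using assms(1,2) neg minus by unfold_locales (auto simp: free_algebra_def a_inv_def)
qed (use assms in \<open>auto simp: free_algebra_def\<close>)

section \<open>The skew Laurent model of the quantum disc\<close>

lemma poly_mapping_induct [case_names zero single add]: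
  fixes x :: "'a \<Rightarrow>\<^sub>0 'b::monoid_add"
  assumes "P 0" and "\<And>w c. P (Poly_Mapping.single w c)" and "\<And>x y. P x \<Longrightarrow> P y \<Longrightarrow> P (x + y)"
  shows "P x"
proof (induction x rule: update_induct)
  case const
  show ?case by (fact assms(1))
next
  case (update f a b)
  have "Poly_Mapping.update a b f = f + Poly_Mapping.single a b"
    by (rule poly_mapping_eqI)
      (use update in \<open>auto simp: lookup_update lookup_add lookup_single when_def in_keys_iff\<close>)
  then show ?case using update assms by simp
qed

lemma const_commute: "x * const c = const c * (x :: 'g list \<Rightarrow>\<^sub>0 complex)"
  by (induction x rule: poly_mapping_induct)
    (simp_all add: const_def mult_single algebra_simps)

lemma const_left_commute: "x * (const c * y) = const c * (x * (y :: 'g list \<Rightarrow>\<^sub>0 complex))"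
  by (metis const_commute mult.assoc)

lemma const_simps:
  "const (a + b) = const a + const b" "const (a - b) = const a - const b"
  "const (a * b) = const a * const b" "const 1 = 1" "const 0 = 0" "const (- a) = - const a"
  by (simp_all add: const_def single_add single_diff mult_single single_uminus)

lemma single_conv_const: "Poly_Mapping.single w c = const c * Poly_Mapping.single w 1"
  by (simp add: const_def mult_single)

lemma single_Nil: "Poly_Mapping.single [] (1::complex) = 1"
  by (metis single_one zero_list_def)

lemma single_Cons: "Poly_Mapping.single (g # w) (1::complex) = var g * Poly_Mapping.single w 1"
  by (simp add: var_def mult_single plus_list_def)

lemma free_algebra_induct [case_names const var add mult]:
  fixes x :: "'g list \<Rightarrow>\<^sub>0 complex"
  assumes "\<And>c. P (const c)" and "\<And>g. P (var g)"
    and "\<And>a b. P a \<Longrightarrow> P b \<Longrightarrow> P (a + b)" and "\<And>a b. P a \<Longrightarrow> P b \<Longrightarrow> P (a * b)"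
  shows "P x"
proof (induction x rule: poly_mapping_induct)
  case zero
  show ?case using assms(1)[of 0] by (simp add: const_simps)
next
  case (single w c)
  have "P (Poly_Mapping.single w 1)"
  proof (induction w)
    case Nil
    show ?case using assms(1)[of 1] by (simp add: single_Nil const_simps)
  next
    case (Cons g w)
    then show ?case using assms(2,4) by (simp add: single_Cons)
  qed
  then show ?case using assms(1,4) by (simp add: single_conv_const[of w c])
qed (use assms(3) in blast)

text \<open>The substitution y -> c y. Since t y = q^2 y t, moving t^k from the left to the right of
  p(y) turns p into \<open>scale (q powi (2 * k)) p\<close>.\<close>

definition scale :: "complex \<Rightarrow> complex poly \<Rightarrow> complex poly" where
  "scale c p = pcompose p [:0, c:]"

lemma scale_simps [simp]:
  "scale c 0 = 0" "scale c 1 = 1" "scale 1 p = p" "scale c [:a:] = [:a:]"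
  by (simp_all add: scale_def pcompose_1)

lemma scale_add: "scale c (p + r) = scale c p + scale c r"
  by (simp add: scale_def pcompose_add)

lemma scale_mult: "scale c (p * r) = scale c p * scale c r"
  by (simp add: scale_def pcompose_mult)

lemma scale_smult: "scale c (smult a p) = smult a (scale c p)"
  by (simp add: scale_def pcompose_smult)

lemma scale_pCons: "scale c (pCons a p) = pCons a (smult c (scale c p))"
  by (simp add: scale_def pcompose_pCons)

lemma scale_scale [simp]: "scale c (scale d p) = scale (c * d) p"
proof -
  have "pcompose (pcompose p [:0, d:]) [:0, c:] = pcompose p (pcompose [:0, d:] [:0, c:])"
    by (rule pcompose_assoc[symmetric])
  then show ?thesis by (simp add: scale_def pcompose_pCons mult.commute)
qed

lemma degree_scale: "c \<noteq> 0 \<Longrightarrow> degree (scale c p) = degree p"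
  by (simp add: scale_def degree_pcompose)

lemma scale_eq_0_iff: "c \<noteq> 0 \<Longrightarrow> scale c p = 0 \<longleftrightarrow> p = 0"
  by (metis mult.commute right_inverse scale_scale scale_simps(1,3))

section \<open>Degrees of words and Laurent coefficients\<close>

primrec gen_degree :: "disc_gen \<Rightarrow> int" where
  "gen_degree Z = 1"
| "gen_degree Zs = -1"

definition word_degree :: "disc_gen list \<Rightarrow> int" where
  "word_degree w = sum_list (map gen_degree w)"

lemma word_degree_simps [simp]:
  "word_degree [] = 0" "word_degree (g # w) = gen_degree g + word_degree w"
  "word_degree (u @ w) = word_degree u + word_degree w"
  by (simp_all add: word_degree_def)

text \<open>The quantum disc embeds into the skew Laurent polynomial ring over \<open>\<complex>[y]\<close> in a variable \<open>t\<close>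
  with \<open>t y = q\<^sup>2 y t\<close>, by \<open>z \<mapsto> t\<close> and \<open>z\<^sup>* \<mapsto> t\<^sup>-\<^sup>1 (1 - y)\<close>, so that \<open>y = 1 - z z\<^sup>*\<close>.
  A word \<open>w\<close> is sent to \<open>word_coeff q w \<cdot> t\<^sup>d\<close>, where \<open>d = word_degree w\<close>, and \<open>symbol q x k\<close> is
  the coefficient of \<open>t\<^sup>k\<close> in the image of \<open>x\<close>.\<close>

primrec gen_coeff :: "complex \<Rightarrow> disc_gen \<Rightarrow> complex poly" where
  "gen_coeff q Z = 1"
| "gen_coeff q Zs = [:1, - inverse (q\<^sup>2):]"

primrec word_coeff :: "complex \<Rightarrow> disc_gen list \<Rightarrow> complex poly" where
  "word_coeff q [] = 1"
| "word_coeff q (g # w) =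
     gen_coeff q g * scale (q powi (2 * gen_degree g)) (word_coeff q w)"

definition symbol :: "complex \<Rightarrow> (disc_gen list \<Rightarrow>\<^sub>0 complex) \<Rightarrow> int \<Rightarrow> complex poly" where
  "symbol q x k = (\<Sum>w\<in>Poly_Mapping.keys x.
     if word_degree w = k then smult (Poly_Mapping.lookup x w) (word_coeff q w) else 0)"

text \<open>Words outside the support contribute 0, so the sums for \<open>x\<close>,
  \<open>y\<close> and \<open>x + y\<close> can be compared over one common index set.\<close>

lemma symbol_superset:
  assumes "finite S" "Poly_Mapping.keys x \<subseteq> S"
  shows "symbol q x k =
    (\<Sum>w\<in>S. if word_degree w = k then smult (Poly_Mapping.lookup x w) (word_coeff q w) else 0)"
  unfolding symbol_def by (rule sum.mono_neutral_left) (use assms in \<open>auto simp: in_keys_iff\<close>)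

lemma symbol_single:
  "symbol q (Poly_Mapping.single w c) k = (if word_degree w = k then smult c (word_coeff q w) else 0)"
  by (subst symbol_superset[of "{w}"]) auto

lemma symbol_0 [simp]: "symbol q 0 k = 0"
  by (simp add: symbol_def)

lemma symbol_add: "symbol q (x + y) k = symbol q x k + symbol q y k"
proof -
  let ?S = "Poly_Mapping.keys x \<union> Poly_Mapping.keys y"
  show ?thesis
    by (subst (1 2 3) symbol_superset[of ?S])
      (auto simp: lookup_add smult_add_left sum.distrib[symmetric] keys_add intro!: sum.cong)
qed

lemma symbol_const_mult: "symbol q (const c * x) k = smult c (symbol q x k)"
proof (induction x rule: poly_mapping_induct)
  case (single w d)
  then show ?case by (simp add: const_def mult_single symbol_single)
qed (simp_all add: symbol_add algebra_simps smult_add_right)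

lemma symbol_const: "symbol q (const c) k = (if k = 0 then [:c:] else 0)"
  by (simp add: const_def symbol_single zero_list_def one_pCons)

lemma symbol_uminus: "symbol q (- x) k = - symbol q x k"
  by (metis symbol_0 symbol_add add.right_inverse add_eq_0_iff)

lemma symbol_diff: "symbol q (x - y) k = symbol q x k - symbol q y k"
  by (metis symbol_add symbol_uminus add_uminus_conv_diff)

lemma symbol_sum: "symbol q (sum f S) k = (\<Sum>i\<in>S. symbol q (f i) k)"
  by (induction S rule: infinite_finite_induct) (simp_all add: symbol_add)

lemma finite_symbol_support: "finite {k. symbol q x k \<noteq> 0}"
proof (rule finite_subset)
  show "{k. symbol q x k \<noteq> 0} \<subseteq> word_degree ` Poly_Mapping.keys x"
  proof (rule subsetI, rule ccontr)
    fix k assume "k \<in> {k. symbol q x k \<noteq> 0}" "k \<notin> word_degree ` Poly_Mapping.keys x"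
    moreover from this have "symbol q x k = 0"
      unfolding symbol_def by (intro sum.neutral) auto
    ultimately show False by simp
  qed
qed simp

section \<open>Multiplication of Laurent coefficients\<close>

locale qdisc_param =
  fixes q :: complex
  assumes q_nonzero: "q \<noteq> 0"
    and q_not_root: "\<And>m::nat. m > 0 \<Longrightarrow> q ^ m \<noteq> 1"
begin

lemma q_powi_eq_1_iff: "q powi n = 1 \<longleftrightarrow> n = 0"
proof
  assume 1: "q powi n = 1"
  show "n = 0"
  proof (rule ccontr)
    assume "n \<noteq> 0"
    then have "nat \<bar>n\<bar> > 0" by simp
    moreover have "q ^ nat \<bar>n\<bar> = 1"
      using 1 by (auto simp: power_int_def abs_if power_inverse split: if_splits)
    ultimately show False using q_not_root by blast
  qed
qed simp

lemma q_powi_eq_iff: "q powi m = q powi n \<longleftrightarrow> m = n"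
  using q_powi_eq_1_iff[of "m - n"] q_nonzero by (simp add: power_int_diff)

lemma word_coeff_append:
  "word_coeff q (u @ w) = word_coeff q u * scale (q powi (2 * word_degree u)) (word_coeff q w)"
  by (induction u)
    (simp_all add: scale_mult mult.assoc q_nonzero flip: power_int_add add: distrib_left)

lemma symbol_mult_single:
  "symbol q (x * Poly_Mapping.single w c) n =
     symbol q x (n - word_degree w) *
     scale (q powi (2 * (n - word_degree w))) (smult c (word_coeff q w))"
proof (induction x rule: poly_mapping_induct)
  case (single u d)
  have "word_degree u + word_degree w = n \<longleftrightarrow> word_degree u = n - word_degree w" by auto
  then show ?case
    by (auto simp: mult_single symbol_single plus_list_def word_coeff_append scale_smult mult.commute)
qed (simp_all add: symbol_add algebra_simps)

text \<open>Twisted convolution: (a t^k)(b t^l) equals a times the rescaled b times t^(k+l). The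
  finite set \<open>S\<close> is left free, so that it may be empty or be enlarged by a chosen
  index.\<close>

lemma symbol_mult:
  assumes "finite S" and "\<And>k. symbol q x k \<noteq> 0 \<Longrightarrow> k \<in> S"
  shows "symbol q (x * y) n = (\<Sum>k\<in>S. symbol q x k * scale (q powi (2 * k)) (symbol q y (n - k)))"
proof (induction y rule: poly_mapping_induct)
  case (single w c)
  let ?d = "n - word_degree w"
  have "(\<Sum>k\<in>S. symbol q x k * scale (q powi (2 * k)) (symbol q (Poly_Mapping.single w c) (n - k))) =
      (\<Sum>k\<in>S. if k = ?d then symbol q x k * scale (q powi (2 * k)) (smult c (word_coeff q w)) else 0)"
    by (rule sum.cong) (auto simp: symbol_single)
  also have "\<dots> = symbol q (x * Poly_Mapping.single w c) n"
    using assms by (auto simp: symbol_mult_single)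
  finally show ?case ..
qed (simp_all add: symbol_add scale_add algebra_simps sum.distrib)

lemma symbol_mult_homogeneous:
  assumes "\<And>k. k \<noteq> d \<Longrightarrow> symbol q x k = 0"
  shows "symbol q (x * y) n = symbol q x d * scale (q powi (2 * d)) (symbol q y (n - d))"
  by (subst symbol_mult[of "{d}"]) (use assms in auto)

section \<open>The element y and the descent of Laurent coefficients to the quotient\<close>

abbreviation cls :: "(disc_gen list \<Rightarrow>\<^sub>0 complex) \<Rightarrow> disc" where
  "cls \<equiv> residue_class (disc_relations q)"

abbreviation z :: "disc_gen list \<Rightarrow>\<^sub>0 complex" where "z \<equiv> var Z"
abbreviation zs :: "disc_gen list \<Rightarrow>\<^sub>0 complex" where "zs \<equiv> var Zs"

definition yq :: "disc_gen list \<Rightarrow>\<^sub>0 complex" where "yq = 1 - z * zs"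

lemma symbol_1: "symbol q 1 k = (if k = 0 then 1 else 0)"
  unfolding single_Nil[symmetric] by (auto simp: symbol_single)

lemma symbol_z: "symbol q z k = (if k = 1 then 1 else 0)"
  by (auto simp: var_def symbol_single)

text \<open>With coefficients written on the left, t^-1 (1 - y) becomes (1 - q^-2 y) t^-1.\<close>

lemma symbol_zs: "symbol q zs k = (if k = -1 then [:1, - inverse (q\<^sup>2):] else 0)"
  by (auto simp: var_def symbol_single)

lemma symbol_z_mult: "symbol q (z * x) n = scale (q\<^sup>2) (symbol q x (n - 1))"
  by (subst symbol_mult_homogeneous[of 1]) (auto simp: symbol_z)

lemma symbol_zs_mult:
  "symbol q (zs * x) n = [:1, - inverse (q\<^sup>2):] * scale (inverse (q\<^sup>2)) (symbol q x (n + 1))"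
  by (subst symbol_mult_homogeneous[of "-1"]) (auto simp: symbol_zs power_int_minus)

lemma symbol_yq: "symbol q yq k = (if k = 0 then [:0, 1:] else 0)"
  using q_nonzero
  by (auto simp: yq_def symbol_diff symbol_1 symbol_z_mult symbol_zs scale_pCons one_pCons)

lemma symbol_yq_mult: "symbol q (yq * x) k = [:0, 1:] * symbol q x k"
  by (subst symbol_mult_homogeneous[of 0]) (auto simp: symbol_yq)

text \<open>The elements all of whose coefficients vanish form a two-sided ideal containing the
  defining relation, hence containing everything that is 0 in the quotient.\<close>

lemma symbol_eqI:
  assumes "cls a = cls b"
  shows "symbol q a k = symbol q b k"
proof -
  let ?I = "{x. \<forall>k. symbol q x k = 0}"
  have "ideal ?I free_algebra"
  proof (rule ideal_free_algebraI)
    fix u v assume u: "u \<in> ?I"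
    show "u * v \<in> ?I"
      \<comment> \<open>The left factor has empty support, so the convolution is an empty
        sum.\<close>
      using u symbol_mult[of "{}" u v] by simp
    show "v * u \<in> ?I"
      using u symbol_mult[OF finite_symbol_support[of q v], of v u] by simp
  qed (auto simp: symbol_add)
  moreover have "disc_relations q \<subseteq> ?I"
    using q_nonzero
    by (auto simp: disc_relations_def symbol_diff symbol_add symbol_1 symbol_z_mult symbol_zs_mult
        symbol_z symbol_zs mult.assoc symbol_const_mult symbol_const scale_pCons one_pCons)
  ultimately have "a - b \<in> ?I"
    using assms by (rule residue_class_ideal_minimal)
  then show ?thesis by (simp add: symbol_diff)
qed


text \<open>Reduces an identity in the disc to an identity in the free algebra: the difference of
  the two sides is exhibited as a left multiple of the relator.\<close>

lemma cls_eq_of_relation: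
  assumes "u - v = a * (z * zs - (const (q\<^sup>2) * zs * z + const (1 - q\<^sup>2)))"
  shows "cls u = cls v"
proof -
  have "cls (z * zs) = cls (const (q\<^sup>2) * zs * z + const (1 - q\<^sup>2))"
    by (rule residue_class_eqI) (simp add: disc_relations_def)
  then have "cls (z * zs - (const (q\<^sup>2) * zs * z + const (1 - q\<^sup>2))) = cls 0"
    by (simp add: residue_class_eq_iff)
  from residue_class_mult[OF refl this, of a] show ?thesis
    by (simp add: assms[symmetric] residue_class_eq_iff)
qed

lemma cls_z_yq: "cls (z * yq) = cls (const (q\<^sup>2) * yq * z)"
  by (rule cls_eq_of_relation[where a = "- z"])
    (simp add: yq_def algebra_simps const_simps const_left_commute const_commute[of z])

text \<open>The relation solved for \<open>zs * z\<close>, with \<open>z * zs\<close> rewritten as 1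
  - y.\<close>

lemma cls_zs_z: "cls (zs * z) = cls (1 - const (inverse (q\<^sup>2)) * yq)"
proof -
  have c: "const (inverse (q\<^sup>2)) * const (q\<^sup>2) = (1 :: disc_gen list \<Rightarrow>\<^sub>0 complex)"
    using q_nonzero by (simp flip: const_simps(3) add: const_simps(4))
  have c': "const (inverse (q\<^sup>2)) * (const (q\<^sup>2) * x) = x" for x :: "disc_gen list \<Rightarrow>\<^sub>0 complex"
    by (simp add: c flip: mult.assoc)
  show ?thesis
    by (rule cls_eq_of_relation[where a = "- const (inverse (q\<^sup>2))"])
      (simp add: yq_def algebra_simps const_simps c c')
qed

lemma cls_zs_yq: "cls (zs * yq) = cls (const (inverse (q\<^sup>2)) * yq * zs)"
proof -
  have "cls (zs * yq) = cls (zs + (- 1) * (zs * z * zs))"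
    by (simp add: yq_def algebra_simps)
  also have "\<dots> = cls (zs + (- 1) * ((1 - const (inverse (q\<^sup>2)) * yq) * zs))"
    by (intro residue_class_add residue_class_mult refl cls_zs_z)
  also have "\<dots> = cls (const (inverse (q\<^sup>2)) * yq * zs)"
    by (simp add: algebra_simps)
  finally show ?thesis .
qed

section \<open>Polynomials in y and normal forms of words\<close>

definition peval :: "complex poly \<Rightarrow> (disc_gen list \<Rightarrow>\<^sub>0 complex)" where
  "peval p = fold_coeffs (\<lambda>a x. const a + yq * x) p 0"

lemma peval_0 [simp]: "peval 0 = 0"
  by (simp add: peval_def)

lemma peval_pCons: "peval (pCons a p) = const a + yq * peval p"
  by (cases "p = 0 \<and> a = 0") (auto simp: peval_def const_simps)

lemma peval_add: "peval (p + r) = peval p + peval r"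
proof (induction p arbitrary: r)
  case (pCons a p)
  then show ?case by (cases r) (simp add: peval_pCons const_simps algebra_simps)
qed simp

lemma peval_smult: "peval (smult c p) = const c * peval p"
proof (induction p)
  case (pCons a p)
  then show ?case by (simp add: peval_pCons const_simps distrib_left const_left_commute[of yq])
qed simp

text \<open>Equality holds already in the free algebra, because scalars are central and all other
  factors are powers of the single element \<open>yq\<close>.\<close>

lemma peval_mult: "peval (p * r) = peval p * peval r"
  by (induction p) (simp_all add: peval_pCons peval_add peval_smult const_simps algebra_simps)

lemma peval_simps [simp]: "peval 1 = 1" "peval [:a:] = const a" "peval [:0, 1:] = yq"
  by (simp_all add: peval_pCons const_simps one_pCons)

lemma symbol_peval_mult: "symbol q (peval p * x) k = p * symbol q x k"
proof (induction p)
  case (pCons a p)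
  have "symbol q (peval (pCons a p) * x) k = smult a (symbol q x k) + [:0, 1:] * (p * symbol q x k)"
    by (simp add: peval_pCons distrib_right symbol_add symbol_const_mult symbol_yq_mult mult.assoc
        pCons.IH)
  then show ?case by (simp add: mult_pCons_left)
qed simp

text \<open>Each time \<open>u\<close> crosses a factor y it produces a factor \<open>c\<close>, so
  y^m picks up c^m.\<close>

lemma cls_skew_peval:
  assumes "cls (u * yq) = cls (const c * yq * u)"
  shows "cls (u * peval p) = cls (peval (scale c p) * u)"
proof (induction p)
  case (pCons a p)
  have "cls (u * peval (pCons a p)) = cls (const a * u + u * yq * peval p)"
    by (simp add: peval_pCons distrib_left const_commute mult.assoc)
  also have "\<dots> = cls (const a * u + const c * yq * u * peval p)"
    by (intro residue_class_add residue_class_mult refl assms)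
  also have "\<dots> = cls (const a * u + const c * yq * (u * peval p))"
    by (simp add: mult.assoc)
  also have "\<dots> = cls (const a * u + const c * yq * (peval (scale c p) * u))"
    by (intro residue_class_add residue_class_mult refl pCons.IH)
  also have "\<dots> = cls (peval (scale c (pCons a p)) * u)"
    by (simp add: scale_pCons peval_pCons peval_smult algebra_simps const_left_commute)
  finally show ?case .
qed simp

lemmas cls_z_peval = cls_skew_peval[OF cls_z_yq]
lemmas cls_zs_peval = cls_skew_peval[OF cls_zs_yq]

text \<open>As \<open>nat\<close> sends negative integers to 0, this is a power of \<open>z\<close>
  for k >= 0 and a power of \<open>zs\<close> for k <= 0. It generates the part of degree
  \<open>k\<close> as a module over the polynomials in y.\<close>

definition base :: "int \<Rightarrow> (disc_gen list \<Rightarrow>\<^sub>0 complex)" where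
  "base k = z ^ nat k * zs ^ nat (- k)"

text \<open>For k >= 0 the power of \<open>z\<close> just grows. For k < 0 the new \<open>z\<close>
  meets a \<open>zs\<close>, and the pair collapses to 1 - y.\<close>

lemma z_base: "\<exists>p. cls (z * base k) = cls (peval p * base (k + 1))"
proof (cases "k \<ge> 0")
  case True
  then have "z * base k = peval 1 * base (k + 1)"
    by (simp add: base_def nat_add_distrib)
  then show ?thesis by metis
next
  case False
  then have "nat (- k) = Suc (nat (- (k + 1)))" by simp
  then have "z * base k = (1 - yq) * base (k + 1)"
    using False by (simp add: base_def yq_def mult.assoc)
  also have "\<dots> = peval (1 - [:0, 1:]) * base (k + 1)"
    by (simp add: peval_pCons const_simps one_pCons algebra_simps)
  finally show ?thesis by metis
qed

text \<open>Mirror image of \<open>z_base\<close>; here the collapsing pair is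
  \<open>zs * z\<close>, which equals 1 - q^-2 y.\<close>

lemma zs_base: "\<exists>p. cls (zs * base k) = cls (peval p * base (k - 1))"
proof (cases "k \<le> 0")
  case True
  then have "nat (- (k - 1)) = Suc (nat (- k))" by simp
  then have "zs * base k = peval 1 * base (k - 1)"
    using True by (simp add: base_def)
  then show ?thesis by metis
next
  case False
  then have "nat k = Suc (nat (k - 1))" by simp
  then have "zs * base k = zs * z * base (k - 1)"
    using False by (simp add: base_def mult.assoc)
  then have "cls (zs * base k) = cls ((1 - const (inverse (q\<^sup>2)) * yq) * base (k - 1))"
    using residue_class_mult[OF cls_zs_z refl] by metis
  also have "1 - const (inverse (q\<^sup>2)) * yq = peval [:1, - inverse (q\<^sup>2):]"
    by (simp add: peval_pCons const_simps const_commute)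
  finally show ?thesis by blast
qed

text \<open>A letter put in front of a normal form is pushed through the polynomial, which rescales
  it, and is then absorbed by \<open>base\<close> at the cost of another polynomial factor.\<close>

lemma word_normal_form: "\<exists>p. cls (Poly_Mapping.single w 1) = cls (peval p * base (word_degree w))"
proof (induction w)
  case Nil
  have "Poly_Mapping.single [] 1 = peval 1 * base (word_degree [])"
    by (simp add: single_Nil base_def)
  then show ?case by metis
next
  case (Cons g w)
  let ?k = "word_degree w"
  from Cons obtain p where p: "cls (Poly_Mapping.single w 1) = cls (peval p * base ?k)" by blast
  obtain c r where c: "cls (var g * peval p) = cls (peval (scale c p) * var g)"
    and r: "cls (var g * base ?k) = cls (peval r * base (gen_degree g + ?k))"
    using cls_z_peval cls_zs_peval z_base[of ?k] zs_base[of ?k]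
    by (cases g) (auto simp: add.commute)
  have "cls (Poly_Mapping.single (g # w) 1) = cls (var g * (peval p * base ?k))"
    unfolding single_Cons by (intro residue_class_mult refl p)
  also have "\<dots> = cls (peval (scale c p) * var g * base ?k)"
    unfolding mult.assoc[symmetric] by (intro residue_class_mult refl c)
  also have "\<dots> = cls (peval (scale c p) * (peval r * base (gen_degree g + ?k)))"
    unfolding mult.assoc by (intro residue_class_mult refl r)
  also have "\<dots> = cls (peval (scale c p * r) * base (word_degree (g # w)))"
    by (simp add: peval_mult mult.assoc)
  finally show ?case by blast
qed

section \<open>Homogeneous components and faithfulness of the Laurent model\<close>

definition component :: "int \<Rightarrow> (disc_gen list \<Rightarrow>\<^sub>0 complex) \<Rightarrow> (disc_gen list \<Rightarrow>\<^sub>0 complex)" where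
  "component k x = (\<Sum>w\<in>{w \<in> Poly_Mapping.keys x. word_degree w = k}.
     Poly_Mapping.single w (Poly_Mapping.lookup x w))"

lemma sum_component: "(\<Sum>k\<in>word_degree ` Poly_Mapping.keys x. component k x) = x"
proof -
  have "(\<Sum>k\<in>word_degree ` Poly_Mapping.keys x. component k x) =
      (\<Sum>w\<in>Poly_Mapping.keys x. Poly_Mapping.single w (Poly_Mapping.lookup x w))"
    unfolding component_def by (rule sum.image_gen[symmetric]) simp
  also have "\<dots> = x"
    by (rule poly_mapping_eqI) (auto simp: lookup_sum lookup_single when_def in_keys_iff)
  finally show ?thesis .
qed

lemma symbol_component: "symbol q (component k x) n = (if n = k then symbol q x k else 0)"
proof -
  have "symbol q (component k x) n = (\<Sum>w\<in>{w \<in> Poly_Mapping.keys x. word_degree w = k}.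
      if n = k then smult (Poly_Mapping.lookup x w) (word_coeff q w) else 0)"
    unfolding component_def symbol_sum by (rule sum.cong) (auto simp: symbol_single)
  also have "\<dots> = (if n = k then symbol q x k else 0)"
    unfolding symbol_def by (auto simp: sum.inter_filter intro!: sum.cong sum.neutral)
  finally show ?thesis .
qed

lemma component_normal_form: "\<exists>p. cls (component k x) = cls (peval p * base k)"
proof -
  \<comment> \<open>Finite set and coefficients are arbitrary here, so that the induction can remove
    one word without changing \<open>x\<close>.\<close>
  have "\<exists>p. cls (\<Sum>w\<in>S. Poly_Mapping.single w (f w)) = cls (peval p * base k)"
    if "finite S" "\<And>w. w \<in> S \<Longrightarrow> word_degree w = k" for S and f :: "disc_gen list \<Rightarrow> complex"
    using that
  proof (induction S)
    case empty
    have "cls (\<Sum>w\<in>{}. Poly_Mapping.single w (f w)) = cls (peval 0 * base k)" by simp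
    then show ?case by blast
  next
    case (insert w S)
    then obtain p where p: "cls (\<Sum>w\<in>S. Poly_Mapping.single w (f w)) = cls (peval p * base k)"
      by blast
    obtain r where r: "cls (Poly_Mapping.single w 1) = cls (peval r * base k)"
      using word_normal_form insert.prems by blast
    have "cls (\<Sum>w\<in>insert w S. Poly_Mapping.single w (f w)) =
        cls (const (f w) * Poly_Mapping.single w 1 + (\<Sum>w\<in>S. Poly_Mapping.single w (f w)))"
      using insert.hyps by (simp add: single_conv_const[of w "f w"])
    also have "\<dots> = cls (const (f w) * (peval r * base k) + peval p * base k)"
      by (intro residue_class_add residue_class_mult refl p r)
    also have "\<dots> = cls (peval (smult (f w) r + p) * base k)"
      by (simp add: peval_add peval_smult algebra_simps)
    finally show ?case by blast
  qed
  note * = this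
  show ?thesis unfolding component_def by (rule *) simp_all
qed

lemma symbol_z_power: "symbol q (z ^ n) k = (if k = int n then 1 else 0)"
  by (induction n arbitrary: k) (auto simp: symbol_1 symbol_z_mult)

lemma symbol_zs_power:
  "k \<noteq> - int n \<Longrightarrow> symbol q (zs ^ n) k = 0"
  "symbol q (zs ^ n) (- int n) \<noteq> 0"
proof (induction n arbitrary: k)
  case (Suc n)
  {
    case 1
    then show ?case using Suc.IH(1)[of "k + 1"] by (simp add: symbol_zs_mult)
  next
    case 2
    have "- int (Suc n) + 1 = - int n" by simp
    then show ?case
      using Suc.IH(2) q_nonzero by (simp add: symbol_zs_mult scale_eq_0_iff del: mult_pCons_left)
  }
qed (auto simp: symbol_1)

lemma symbol_base:
  "n \<noteq> k \<Longrightarrow> symbol q (base k) n = 0"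
  "symbol q (base k) k \<noteq> 0"
proof -
  consider "k \<ge> 0" "base k = z ^ nat k" | "k \<le> 0" "base k = zs ^ nat (- k)"
    unfolding base_def by (cases "k \<ge> 0") auto
  note cases = this
  show "symbol q (base k) n = 0" if "n \<noteq> k"
    using that by (cases rule: cases) (auto simp: symbol_z_power symbol_zs_power)
  show "symbol q (base k) k \<noteq> 0"
    using symbol_zs_power(2)[of "nat (- k)"] by (cases rule: cases) (auto simp: symbol_z_power)
qed

text \<open>Injectivity of the Laurent model. The component of degree \<open>k\<close> is p(y) times
  \<open>base k\<close>, with coefficient \<open>p * symbol q (base k) k\<close>. The second factor
  is nonzero and complex polynomials form a domain, so p = 0.\<close>

lemma cls_eq_0I:
  assumes "\<And>k. symbol q x k = 0"
  shows "cls x = cls 0"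
proof -
  have *: "cls (component k x) = cls 0" for k
  proof -
    obtain p where p: "cls (component k x) = cls (peval p * base k)"
      using component_normal_form by blast
    then have "symbol q (component k x) k = p * symbol q (base k) k"
      by (simp add: symbol_eqI[OF p] symbol_peval_mult)
    then have "p = 0"
      using assms symbol_base(2)[of k] by (simp add: symbol_component)
    then show ?thesis using p by simp
  qed
  have "cls (\<Sum>k\<in>S. component k x) = cls 0" if "finite S" for S
    using that
  proof (induction S)
    case (insert k S)
    then show ?case using residue_class_add[OF *[of k] insert.IH] by simp
  qed simp
  from this[of "word_degree ` Poly_Mapping.keys x"] show ?thesis by (simp add: sum_component)
qed

lemma cls_eq_iff: "cls a = cls b \<longleftrightarrow> (\<forall>k. symbol q a k = symbol q b k)"
proof
  assume "\<forall>k. symbol q a k = symbol q b k"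
  then have "cls (a - b) = cls 0"
    by (intro cls_eq_0I) (simp add: symbol_diff)
  then show "cls a = cls b" by (simp add: residue_class_eq_iff)
qed (blast intro: symbol_eqI)

section \<open>The grading described by Laurent coefficients\<close>

definition homogeneous :: "int \<Rightarrow> (disc_gen list \<Rightarrow>\<^sub>0 complex) \<Rightarrow> bool" where
  "homogeneous k x \<longleftrightarrow> (\<forall>n. n \<noteq> k \<longrightarrow> symbol q x n = 0)"

lemma homogeneous_mult:
  assumes "homogeneous k u" "homogeneous l v"
  shows "homogeneous (k + l) (u * v)"
  using assms unfolding homogeneous_def
  by (auto simp: symbol_mult_homogeneous[of k])

lemma homogeneous_monomial: "homogeneous (int i - int j) (z ^ i * zs ^ j)"
  using homogeneous_mult[of "int i" "z ^ i" "- int j" "zs ^ j"]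
  by (simp add: homogeneous_def symbol_z_power symbol_zs_power)

lemma cls_component:
  assumes "homogeneous k x"
  shows "cls (component k x) = cls x"
  using assms by (auto simp: cls_eq_iff symbol_component homogeneous_def)

lemma disc_grade_conv:
  "disc_grade q k = linear_span (qdisc q) {cls (z ^ i * zs ^ j) | i j. int i - int j = k}"
  by (simp add: disc_grade_def disc_z_def disc_zs_def qdisc_def pow_presented_algebra
      mult_presented_algebra)

lemma disc_grade_add:
  "cls a \<in> disc_grade q k \<Longrightarrow> cls b \<in> disc_grade q k \<Longrightarrow> cls (a + b) \<in> disc_grade q k"
  using linear_span.add[of "cls a" "qdisc q" _ "cls b"]
  by (simp add: disc_grade_def qdisc_def add_presented_algebra)

lemma disc_grade_const_mult: "cls a \<in> disc_grade q k \<Longrightarrow> cls (const c * a) \<in> disc_grade q k"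
  using linear_span.smult[of "cls a" "qdisc q"]
  by (simp add: disc_grade_def qdisc_def smult_presented_algebra)

lemma disc_grade_0: "cls 0 \<in> disc_grade q k"
  using linear_span.zero[of "qdisc q"]
  by (simp add: disc_grade_def qdisc_def zero_presented_algebra)

lemma disc_grade_monomial: "cls (z ^ i * zs ^ j) \<in> disc_grade q (int i - int j)"
  unfolding disc_grade_conv by (rule linear_span.base) auto

text \<open>Multiplying an ordered monomial by y stays in the span: y z^i = q^(-2i) z^i y, and
  putting y = 1 - z zs in the middle gives two ordered monomials with the same i - j. The second has
  both exponents raised, hence the induction is over all \<open>i\<close> and
  \<open>j\<close>.\<close>

lemma disc_grade_yq_power: "cls (yq ^ m * (z ^ i * zs ^ j)) \<in> disc_grade q (int i - int j)"
proof (induction m arbitrary: i j)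
  case (Suc m)
  define c where "c = inverse (q powi (2 * int i))"
  have zy: "cls (yq * z ^ i) = cls (const c * (z ^ i * yq))"
    unfolding cls_eq_iff
    by (auto simp: symbol_yq_mult symbol_const_mult symbol_mult_homogeneous[of "int i"]
        symbol_z_power symbol_yq scale_pCons c_def one_pCons q_nonzero)
  have "cls (yq ^ Suc m * (z ^ i * zs ^ j)) = cls (yq ^ m * (yq * z ^ i) * zs ^ j)"
    by (simp add: power_Suc2 mult.assoc del: power_Suc)
  also have "\<dots> = cls (yq ^ m * (const c * (z ^ i * yq)) * zs ^ j)"
    by (intro residue_class_mult refl zy)
  also have "yq ^ m * (const c * (z ^ i * yq)) * zs ^ j =
      const c * (yq ^ m * (z ^ i * zs ^ j)) + const (- c) * (yq ^ m * (z ^ Suc i * zs ^ Suc j))"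
    by (simp add: yq_def algebra_simps const_simps const_left_commute power_Suc2[of z] power_Suc[of zs]
        del: power_Suc)
  finally show ?case
    using Suc[of i j] Suc[of "Suc i" "Suc j"]
    by (simp only:) (intro disc_grade_add disc_grade_const_mult; simp)
qed (simp add: disc_grade_monomial)

lemma disc_grade_peval: "cls (peval p * (z ^ i * zs ^ j)) \<in> disc_grade q (int i - int j)"
proof -
  \<comment> \<open>The extra power of y absorbs the factor y released by each Horner step.\<close>
  have "cls (yq ^ m * peval p * (z ^ i * zs ^ j)) \<in> disc_grade q (int i - int j)" for m
  proof (induction p arbitrary: m)
    case (pCons a p)
    have "yq ^ m * peval (pCons a p) * (z ^ i * zs ^ j) =
        const a * (yq ^ m * (z ^ i * zs ^ j)) + yq ^ Suc m * peval p * (z ^ i * zs ^ j)"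
      by (simp add: peval_pCons algebra_simps const_left_commute power_Suc2 del: power_Suc)
    then show ?case
      using pCons.IH[of "Suc m"] disc_grade_yq_power disc_grade_add disc_grade_const_mult
      by metis
  qed (simp add: disc_grade_0)
  from this[of 0] show ?thesis by simp
qed

text \<open>One inclusion holds because ordered monomials are homogeneous. For the other, a
  homogeneous element equals its component, whose normal form lies in the span by
  \<open>disc_grade_peval\<close>.\<close>

lemma disc_grade_eq: "disc_grade q k = cls ` {x. homogeneous k x}"
proof
  show "disc_grade q k \<subseteq> cls ` {x. homogeneous k x}"
  proof
    fix v assume "v \<in> disc_grade q k"
    then show "v \<in> cls ` {x. homogeneous k x}"
      unfolding disc_grade_conv
    proof (induction rule: linear_span.induct)
      case zero
      have "homogeneous k 0" by (simp add: homogeneous_def)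
      then show ?case by (auto simp: qdisc_def zero_presented_algebra)
    next
      case (base v)
      then show ?case using homogeneous_monomial by blast
    next
      case (add u v)
      then obtain a b where "homogeneous k a" "homogeneous k b" "u = cls a" "v = cls b" by auto
      moreover from this have "homogeneous k (a + b)" by (simp add: homogeneous_def symbol_add)
      ultimately show ?case by (auto simp: qdisc_def add_presented_algebra)
    next
      case (smult v c)
      then obtain a where "homogeneous k a" "v = cls a" by auto
      moreover from this have "homogeneous k (const c * a)"
        by (simp add: homogeneous_def symbol_const_mult)
      ultimately show ?case by (auto simp: qdisc_def smult_presented_algebra)
    qed
  qed
  show "cls ` {x. homogeneous k x} \<subseteq> disc_grade q k"
  proof clarify
    fix x assume "homogeneous k x"
    moreover obtain p where "cls (component k x) = cls (peval p * base k)"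
      using component_normal_form by blast
    ultimately have "cls x = cls (peval p * base k)"
      by (simp add: cls_component)
    then show "cls x \<in> disc_grade q k"
      using disc_grade_peval[of p "nat k" "nat (- k)"]
      by (cases "k \<ge> 0") (auto simp: base_def)
  qed
qed

end

section \<open>Automorphisms of the quantum disc\<close>

context qdisc_param
begin

section \<open>Units of the quantum disc\<close>

text \<open>Isolates one term of the convolution, as needed for the highest and the lowest
  coefficient of a product.\<close>

lemma symbol_mult_single_term:
  assumes "\<And>k. k \<noteq> m \<Longrightarrow> symbol q u k \<noteq> 0 \<Longrightarrow> symbol q v (m + n - k) = 0"
  shows "symbol q (u * v) (m + n) = symbol q u m * scale (q powi (2 * m)) (symbol q v n)"
proof -
  let ?S = "insert m {k. symbol q u k \<noteq> 0}"
  have "symbol q (u * v) (m + n) =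
      (\<Sum>k\<in>?S. symbol q u k * scale (q powi (2 * k)) (symbol q v (m + n - k)))"
    by (rule symbol_mult) (use finite_symbol_support in auto)
  also have "\<dots> = (\<Sum>k\<in>{m}. symbol q u k * scale (q powi (2 * k)) (symbol q v (m + n - k)))"
    by (rule sum.mono_neutral_right) (use finite_symbol_support assms in auto)
  finally show ?thesis by simp
qed

lemma symbol_mult_yq: "symbol q (x * yq) k = smult (q powi (2 * k)) ([:0, 1:] * symbol q x k)"
  using symbol_mult_single_term[of k x yq 0] by (simp add: symbol_yq scale_pCons)

text \<open>In negative degree the normal form contains a factor \<open>zs\<close>, whose
  coefficient 1 - q^-2 y has the root y = q^2.\<close>

lemma symbol_negative:
  assumes "k < 0"
  shows "poly (symbol q x k) (q\<^sup>2) = 0"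
proof -
  obtain p where p: "cls (component k x) = cls (peval p * base k)"
    using component_normal_form by blast
  have "nat k = 0" "nat (- k) = Suc (nat (- k - 1))" using assms by auto
  then have b: "base k = zs * zs ^ nat (- k - 1)" by (simp add: base_def)
  have "symbol q x k = p * symbol q (base k) k"
    using symbol_eqI[OF p, of k] by (simp add: symbol_component symbol_peval_mult)
  also have "poly \<dots> (q\<^sup>2) = 0"
    using q_nonzero by (simp add: b symbol_zs_mult del: mult_pCons_left)
  finally show ?thesis .
qed

lemma scale_q_powi_eq_0_iff [simp]: "scale (q powi n) p = 0 \<longleftrightarrow> p = 0"
  by (rule scale_eq_0_iff) (simp add: q_nonzero)

text \<open>The highest and the lowest coefficient of a product in \<open>t\<close> are products of such
  coefficients, so a unit is a monomial \<open>c t\<^sup>k\<close>; \<open>k = 0\<close> because the coefficients of negative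
  powers of \<open>t\<close> vanish at \<open>y = q\<^sup>2\<close>.\<close>

lemma unit_is_constant:
  assumes uv: "cls (u * v) = cls 1"
  shows "\<exists>c. c \<noteq> 0 \<and> cls u = cls (const c)"
proof -
  define S T where "S = {k. symbol q u k \<noteq> 0}" and "T = {k. symbol q v k \<noteq> 0}"
  have sym: "symbol q (u * v) k = (if k = 0 then 1 else 0)" for k
    using symbol_eqI[OF uv, of k] by (simp add: symbol_1)
  have "S \<noteq> {}"
    using sym[of 0] symbol_mult[of "{}" u v 0] by (auto simp: S_def)
  moreover have "T \<noteq> {}"
  proof
    assume "T = {}"
    then have "symbol q v k = 0" for k by (auto simp: T_def)
    then show False
      using sym[of 0] symbol_mult[OF finite_symbol_support[of q u], of u v 0] by simp
  qed
  moreover have fin: "finite S" "finite T"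
    unfolding S_def T_def by (rule finite_symbol_support)+
  ultimately have mem: "Max S \<in> S" "Max T \<in> T" "Min S \<in> S" "Min T \<in> T"
    by auto
  have top: "symbol q (u * v) (Max S + Max T) =
      symbol q u (Max S) * scale (q powi (2 * Max S)) (symbol q v (Max T))"
  proof (rule symbol_mult_single_term)
    fix k assume "k \<noteq> Max S" "symbol q u k \<noteq> 0"
    then have "k < Max S" using fin by (simp add: S_def order.not_eq_order_implies_strict)
    then have "Max S + Max T - k \<notin> T" using fin Max_ge by fastforce
    then show "symbol q v (Max S + Max T - k) = 0" by (simp add: T_def)
  qed
  have bot: "symbol q (u * v) (Min S + Min T) =
      symbol q u (Min S) * scale (q powi (2 * Min S)) (symbol q v (Min T))"
  proof (rule symbol_mult_single_term)
    fix k assume "k \<noteq> Min S" "symbol q u k \<noteq> 0"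
    then have "k > Min S" using fin by (simp add: S_def order.not_eq_order_implies_strict)
    then have "Min S + Min T - k \<notin> T" using fin Min_le by fastforce
    then show "symbol q v (Min S + Min T - k) = 0" by (simp add: T_def)
  qed
  have "Max S + Max T = 0"
    using top sym mem by (auto simp: S_def T_def split: if_splits)
  moreover have "Min S + Min T = 0"
    using bot sym mem by (auto simp: S_def T_def split: if_splits)
  moreover have "Min S \<le> Max S" "Min T \<le> Max T"
    using fin mem by auto
  \<comment> \<open>Both extreme sums are 0 while minima do not exceed maxima, so each of
    \<open>u\<close> and \<open>v\<close> has exactly one nonzero coefficient.\<close>
  ultimately have eq: "Min S = Max S" "Min T = Max T" "Max T = - Max S" by auto
  let ?p = "symbol q u (Max S)" and ?r = "symbol q v (Max T)"
  have one: "?p * scale (q powi (2 * Max S)) ?r = 1"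
    using top sym eq by simp
  then have nz: "?p \<noteq> 0" "?r \<noteq> 0" by auto
  have "degree ?p + degree ?r = degree (?p * scale (q powi (2 * Max S)) ?r)"
    using nz by (subst degree_mult_eq) (auto simp: degree_scale q_nonzero)
  then have deg: "degree ?p = 0" "degree ?r = 0"
    by (simp_all add: one)
  then obtain a b where ab: "?p = [:a:]" "?r = [:b:]" by (meson degree_eq_zeroE)
  have "Max S = 0"
    using symbol_negative[of "Max S" u] symbol_negative[of "Max T" v] eq ab nz
    by (cases "Max S" "0 :: int" rule: linorder_cases) auto
  moreover have "symbol q u k = 0" if "k \<noteq> Max S" for k
  proof (rule ccontr)
    assume "symbol q u k \<noteq> 0"
    then have "k \<in> S" by (simp add: S_def)
    then show False using fin that eq(1) by (metis Max_ge Min_le order_antisym)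
  qed
  ultimately have "cls u = cls (const a)"
    using ab by (auto simp: cls_eq_iff symbol_const)
  then show ?thesis using ab nz by auto
qed

section \<open>The ideal generated by commutators\<close>

text \<open>It follows that y A is a two-sided ideal. The property passes to sums and products, and
  the generators commute with y up to a scalar.\<close>

lemma yq_normal: "\<exists>b'. cls (b * yq) = cls (yq * b')"
proof (induction b rule: free_algebra_induct)
  case (const c)
  show ?case by (metis const_commute)
next
  case (var g)
  show ?case
    using cls_z_yq cls_zs_yq
    by (cases g) (metis const_commute mult.assoc)+
next
  case (add a b)
  then obtain a' b' where a': "cls (a * yq) = cls (yq * a')" and b': "cls (b * yq) = cls (yq * b')"
    by blast
  from residue_class_add[OF a' b'] have "cls ((a + b) * yq) = cls (yq * (a' + b'))"
    by (simp add: algebra_simps)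
  then show ?case by blast
next
  case (mult a b)
  then obtain a' b' where a': "cls (a * yq) = cls (yq * a')" and b': "cls (b * yq) = cls (yq * b')"
    by blast
  have "cls (a * b * yq) = cls (yq * (a' * b'))"
    using residue_class_mult[OF refl b', of a] residue_class_mult[OF a' refl, of b']
    by (simp add: mult.assoc)
  then show ?case by blast
qed

lemma cls_commutator_z_zs: "cls (z * zs - zs * z) = cls (const (inverse (q\<^sup>2) - 1) * yq)"
proof -
  have "cls (z * zs - zs * z) = cls (z * zs + (- 1) * (zs * z))" by simp
  also have "\<dots> = cls (z * zs + (- 1) * (1 - const (inverse (q\<^sup>2)) * yq))"
    by (intro residue_class_add residue_class_mult refl cls_zs_z)
  also have "\<dots> = cls (const (inverse (q\<^sup>2) - 1) * yq)"
    by (simp add: yq_def algebra_simps const_simps)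
  finally show ?thesis .
qed

text \<open>The commutator is a derivation in each argument and y A is a two-sided ideal, so it
  suffices to treat pairs of generators.\<close>

lemma commutator_in_ideal: "\<exists>c. cls (a * b - b * a) = cls (yq * c)"
proof -
  define Q where "Q a b \<longleftrightarrow> (\<exists>c. cls (a * b - b * a) = cls (yq * c))" for a b
  have sym: "Q b a" if "Q a b" for a b
  proof -
    from that obtain c where c: "cls (a * b - b * a) = cls (yq * c)" by (auto simp: Q_def)
    have "cls (b * a - a * b) = cls ((- 1) * (a * b - b * a))" by simp
    also have "\<dots> = cls ((- 1) * (yq * c))" by (intro residue_class_mult refl c)
    also have "\<dots> = cls (yq * (- c))" by simp
    finally show ?thesis unfolding Q_def by blast
  qed
  have comm: "Q a b" if "a * b = b * a" for a b
    unfolding Q_def using that by (metis diff_self mult_zero_right)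
  have add: "Q a (b + c)" if bc: "Q a b" "Q a c" for a b c
  proof -
    from bc obtain d e where "cls (a * b - b * a) = cls (yq * d)" "cls (a * c - c * a) = cls (yq * e)"
      by (auto simp: Q_def)
    from residue_class_add[OF this] have "cls (a * (b + c) - (b + c) * a) = cls (yq * (d + e))"
      by (simp add: algebra_simps)
    then show ?thesis unfolding Q_def by blast
  qed
  have mult: "Q a (b * c)" if bc: "Q a b" "Q a c" for a b c
  proof -
    from bc obtain d e where d: "cls (a * b - b * a) = cls (yq * d)"
      and e: "cls (a * c - c * a) = cls (yq * e)"
      by (auto simp: Q_def)
    obtain b' where b': "cls (b * yq) = cls (yq * b')" using yq_normal by blast
    have "cls (a * (b * c) - b * c * a) = cls ((a * b - b * a) * c + b * (a * c - c * a))"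
      by (simp add: algebra_simps)
    also have "\<dots> = cls (yq * d * c + b * (yq * e))"
      by (intro residue_class_add residue_class_mult refl d e)
    also have "\<dots> = cls (yq * d * c + b * yq * e)" by (simp add: mult.assoc)
    also have "\<dots> = cls (yq * d * c + yq * b' * e)"
      by (intro residue_class_add residue_class_mult refl b')
    also have "\<dots> = cls (yq * (d * c + b' * e))" by (simp add: algebra_simps)
    finally show ?thesis unfolding Q_def by blast
  qed
  have gens: "Q (var g) (var h)" for g h
  proof -
    have "Q z zs"
      unfolding Q_def using cls_commutator_z_zs by (metis const_commute)
    then show ?thesis using sym comm by (cases g; cases h) auto
  qed
  \<comment> \<open>The closure facts \<open>add\<close> and \<open>mult\<close> concern the second
    argument; the first one is then reached by swapping with \<open>sym\<close>.\<close>
  have "Q (var g) b" for g b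
    by (induction b rule: free_algebra_induct) (use comm const_commute gens add mult in metis)+
  then have "Q b a"
    by (induction a rule: free_algebra_induct) (use comm const_commute sym add mult in metis)+
  then show ?thesis using sym unfolding Q_def by blast
qed

section \<open>Endomorphisms and automorphisms\<close>

text \<open>Stated for maps on representatives, with every law only modulo the relation, so that the
  ring arithmetic of the free algebra stays available.\<close>

definition endomorphism ::
    "((disc_gen list \<Rightarrow>\<^sub>0 complex) \<Rightarrow> (disc_gen list \<Rightarrow>\<^sub>0 complex)) \<Rightarrow> bool" where
  "endomorphism \<phi> \<longleftrightarrow>
     (\<forall>a b. cls a = cls b \<longrightarrow> cls (\<phi> a) = cls (\<phi> b)) \<and>
     (\<forall>c. cls (\<phi> (const c)) = cls (const c)) \<and>
     (\<forall>a b. cls (\<phi> (a + b)) = cls (\<phi> a + \<phi> b)) \<and>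
     (\<forall>a b. cls (\<phi> (a * b)) = cls (\<phi> a * \<phi> b))"

lemma endomorphismD:
  assumes "endomorphism \<phi>"
  shows "cls a = cls b \<Longrightarrow> cls (\<phi> a) = cls (\<phi> b)"
    and "cls (\<phi> (const c)) = cls (const c)"
    and "cls (\<phi> (a + b)) = cls (\<phi> a + \<phi> b)"
    and "cls (\<phi> (a * b)) = cls (\<phi> a * \<phi> b)"
    and "cls (\<phi> (const c * a)) = cls (const c * \<phi> a)"
    and "cls (\<phi> (a - b)) = cls (\<phi> a - \<phi> b)"
proof -
  show *: "cls a = cls b \<Longrightarrow> cls (\<phi> a) = cls (\<phi> b)" "cls (\<phi> (const c)) = cls (const c)"
    "cls (\<phi> (a + b)) = cls (\<phi> a + \<phi> b)" "cls (\<phi> (a * b)) = cls (\<phi> a * \<phi> b)" for a b c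
    using assms unfolding endomorphism_def by blast+
  show smult: "cls (\<phi> (const c * a)) = cls (const c * \<phi> a)" for a c
    using *(2)[of c] *(4)[of "const c" a] residue_class_mult[OF _ refl] by metis
  have "cls (\<phi> (a + const (- 1) * b)) = cls (\<phi> a + const (- 1) * \<phi> b)"
    using *(3)[of a "const (- 1) * b"] residue_class_add[OF refl smult[of "- 1" b]] by simp
  then show "cls (\<phi> (a - b)) = cls (\<phi> a - \<phi> b)"
    by (simp add: const_simps)
qed

text \<open>Up to a nonzero scalar, y is the commutator of \<open>z\<close> and \<open>zs\<close>,
  so its image is again a multiple of a commutator.\<close>

lemma endomorphism_yq:
  assumes "endomorphism \<phi>"
  shows "\<exists>u. cls (\<phi> yq) = cls (yq * u)"
proof -
  \<comment> \<open>The inverse of the scalar in \<open>cls_commutator_z_zs\<close>, which is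
    nonzero because q^2 is not 1.\<close>
  define d where "d = inverse (inverse (q\<^sup>2) - 1)"
  have "q\<^sup>2 \<noteq> 1" using q_not_root[of 2] by simp
  then have "d * (inverse (q\<^sup>2) - 1) = 1" by (simp add: d_def)
  then have d: "const d * (const (inverse (q\<^sup>2) - 1) * yq) = yq"
    by (metis const_simps(3,4) mult.assoc mult_1)
  obtain c where c: "cls (\<phi> z * \<phi> zs - \<phi> zs * \<phi> z) = cls (yq * c)"
    using commutator_in_ideal by blast
  have "cls yq = cls (const d * (z * zs - zs * z))"
    using residue_class_mult[OF refl cls_commutator_z_zs, of "const d"] by (simp add: d)
  then have "cls (\<phi> yq) = cls (\<phi> (const d * (z * zs - zs * z)))"
    by (rule endomorphismD[OF assms])
  also have "\<dots> = cls (const d * \<phi> (z * zs - zs * z))"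
    by (rule endomorphismD[OF assms])
  also have "\<dots> = cls (const d * (\<phi> (z * zs) - \<phi> (zs * z)))"
    by (intro residue_class_mult refl endomorphismD[OF assms])
  also have "\<dots> = cls (const d * (\<phi> z * \<phi> zs - \<phi> zs * \<phi> z))"
    by (intro residue_class_mult residue_class_diff refl endomorphismD[OF assms])
  also have "\<dots> = cls (const d * (yq * c))"
    by (intro residue_class_mult refl c)
  also have "\<dots> = cls (yq * (const d * c))"
    by (simp add: const_left_commute)
  finally show ?thesis by blast
qed

lemma cls_yq_cancel:
  assumes "cls (yq * a) = cls (yq * b)"
  shows "cls a = cls b"
proof -
  have "[:0, 1:] * symbol q a k = [:0, 1:] * symbol q b k" for k
    using symbol_eqI[OF assms, of k] unfolding symbol_yq_mult .
  then show ?thesis unfolding cls_eq_iff by (metis mult_cancel_left pCons_eq_0_iff zero_neq_one)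
qed

text \<open>Write the images of y under the two maps as y u and y w. Applying \<open>\<phi>\<close>
  to the second gives y = y u \<open>\<phi> w\<close>; cancelling y shows that \<open>u\<close> has
  a right inverse, hence is a scalar.\<close>

lemma automorphism_yq:
  assumes phi: "endomorphism \<phi>" and chi: "endomorphism \<chi>" and inv: "\<And>x. cls (\<phi> (\<chi> x)) = cls x"
  shows "\<exists>c. c \<noteq> 0 \<and> cls (\<phi> yq) = cls (const c * yq)"
proof -
  obtain u where u: "cls (\<phi> yq) = cls (yq * u)" using endomorphism_yq[OF phi] by blast
  obtain w where w: "cls (\<chi> yq) = cls (yq * w)" using endomorphism_yq[OF chi] by blast
  have "cls (yq * 1) = cls (\<phi> (\<chi> yq))" by (simp add: inv)
  also have "\<dots> = cls (\<phi> (yq * w))" by (intro endomorphismD[OF phi] w)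
  also have "\<dots> = cls (\<phi> yq * \<phi> w)" by (rule endomorphismD[OF phi])
  also have "\<dots> = cls (yq * u * \<phi> w)" by (intro residue_class_mult refl u)
  finally have "cls (yq * 1) = cls (yq * (u * \<phi> w))" by (simp add: mult.assoc)
  then obtain c where c: "c \<noteq> 0" "cls u = cls (const c)"
    using unit_is_constant[of u "\<phi> w"] cls_yq_cancel by metis
  have "cls (\<phi> yq) = cls (yq * const c)"
    unfolding u by (intro residue_class_mult refl c)
  then show ?thesis using c(1) const_commute by metis
qed

text \<open>Conjugation by y multiplies the coefficient of t^n by a power of q that determines n,
  since q is not a root of unity.\<close>

lemma homogeneous_of_skew_commute:
  assumes "cls (x * yq) = cls (const (q powi (2 * k)) * yq * x)"
  shows "homogeneous k x"
  unfolding homogeneous_def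
proof (intro allI impI)
  fix n assume "n \<noteq> k"
  have "smult (q powi (2 * n)) ([:0, 1:] * symbol q x n) =
      smult (q powi (2 * k)) ([:0, 1:] * symbol q x n)"
    using symbol_eqI[OF assms, of n]
    unfolding symbol_mult_yq mult.assoc symbol_const_mult symbol_yq_mult .
  then have "smult (q powi (2 * n) - q powi (2 * k)) ([:0, 1:] * symbol q x n) = 0"
    by (simp only: smult_diff_left right_minus_eq)
  moreover have "q powi (2 * n) - q powi (2 * k) \<noteq> 0"
    using \<open>n \<noteq> k\<close> by (simp add: q_powi_eq_iff)
  ultimately show "symbol q x n = 0" by simp
qed

text \<open>Since y is only rescaled, the images of \<open>z\<close> and \<open>zs\<close> keep the
  degrees 1 and -1. The product of these images has degree 1 in y, and the image of
  \<open>zs\<close> already carries a linear factor, so only scalars are left.\<close>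

lemma automorphism_diagonal:
  assumes phi: "endomorphism \<phi>" and chi: "endomorphism \<chi>" and inv: "\<And>x. cls (\<phi> (\<chi> x)) = cls x"
  shows "\<exists>\<alpha>. \<alpha> \<noteq> 0 \<and> cls (\<phi> z) = cls (const \<alpha> * z) \<and> cls (\<phi> zs) = cls (const (inverse \<alpha>) * zs)"
proof -
  obtain c where c: "c \<noteq> 0" "cls (\<phi> yq) = cls (const c * yq)"
    using automorphism_yq[OF assms] by blast
  \<comment> \<open>Apply \<open>\<phi>\<close> to the commutation of \<open>g\<close> with y,
    replace \<open>\<phi> yq\<close> by c y on both sides, and cancel \<open>c\<close>.\<close>
  have skew: "cls (\<phi> g * yq) = cls (const d * yq * \<phi> g)"
    if g: "cls (g * yq) = cls (const d * yq * g)" for g d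
  proof -
    have "cls (const c * (\<phi> g * yq)) = cls (\<phi> g * (const c * yq))"
      by (simp add: const_left_commute)
    also have "\<dots> = cls (\<phi> g * \<phi> yq)" by (intro residue_class_mult refl c(2)[symmetric])
    also have "\<dots> = cls (\<phi> (g * yq))" by (rule endomorphismD(4)[OF phi, symmetric])
    also have "\<dots> = cls (\<phi> (const d * (yq * g)))"
      by (intro endomorphismD(1)[OF phi]) (simp add: g mult.assoc)
    also have "\<dots> = cls (const d * \<phi> (yq * g))" by (rule endomorphismD[OF phi])
    also have "\<dots> = cls (const d * (\<phi> yq * \<phi> g))"
      by (intro residue_class_mult refl endomorphismD(4)[OF phi])
    also have "\<dots> = cls (const d * (const c * yq * \<phi> g))"
      by (intro residue_class_mult refl c(2))
    also have "\<dots> = cls (const c * (const d * yq * \<phi> g))"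
      by (simp add: mult.assoc const_left_commute[of "const d" c])
    finally have "cls (const (inverse c) * (const c * (\<phi> g * yq))) =
        cls (const (inverse c) * (const c * (const d * yq * \<phi> g)))"
      by (rule residue_class_mult[OF refl])
    moreover have "const (inverse c) * (const c * x) = x" for x :: "disc_gen list \<Rightarrow>\<^sub>0 complex"
      using c(1) by (simp add: const_simps(4) flip: mult.assoc const_simps(3))
    ultimately show ?thesis by simp
  qed
  have hz: "homogeneous 1 (\<phi> z)"
    using skew[OF cls_z_yq] by (intro homogeneous_of_skew_commute) simp
  have hzs: "homogeneous (- 1) (\<phi> zs)"
    using skew[OF cls_zs_yq] by (intro homogeneous_of_skew_commute) (simp add: power_int_minus)
  \<comment> \<open>The normal form in degree -1 makes the coefficient of \<open>\<phi> zs\<close>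
    divisible by 1 - q^-2 y.\<close>
  obtain p where p: "cls (component (- 1) (\<phi> zs)) = cls (peval p * base (- 1))"
    using component_normal_form by blast
  have b: "symbol q (\<phi> zs) (- 1) = p * [:1, - inverse (q\<^sup>2):]"
    using symbol_eqI[OF p, of "- 1"]
    by (simp add: symbol_component symbol_peval_mult base_def symbol_zs del: mult_pCons_right)
  define a where "a = symbol q (\<phi> z) 1"
  have "cls (\<phi> z * \<phi> zs) = cls (\<phi> (z * zs))" by (rule endomorphismD(4)[OF phi, symmetric])
  also have "\<dots> = cls (\<phi> (const 1 - yq))" by (simp add: yq_def const_simps)
  also have "\<dots> = cls (\<phi> (const 1) - \<phi> yq)" by (rule endomorphismD[OF phi])
  also have "\<dots> = cls (const 1 - const c * yq)"
    by (intro residue_class_diff endomorphismD(2)[OF phi] c(2))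
  finally have "symbol q (\<phi> z * \<phi> zs) 0 = symbol q (const 1 - const c * yq) 0"
    by (rule symbol_eqI)
  also have "\<dots> = [:1, - c:]"
    by (simp add: symbol_diff symbol_const symbol_const_mult symbol_yq)
  also have "symbol q (\<phi> z * \<phi> zs) 0 = a * scale (q\<^sup>2) (p * [:1, - inverse (q\<^sup>2):])"
    using hz unfolding a_def b[symmetric]
    by (subst symbol_mult_homogeneous[of 1]) (auto simp: homogeneous_def)
  \<comment> \<open>Rescaling by q^2 turns the factor 1 - q^-2 y into 1 - y.\<close>
  also have "scale (q\<^sup>2) (p * [:1, - inverse (q\<^sup>2):]) = scale (q\<^sup>2) p * [:1, - 1:]"
    using q_nonzero by (simp add: scale_mult scale_pCons one_pCons del: mult_pCons_right)
  finally have eq: "a * (scale (q\<^sup>2) p * [:1, - 1:]) = [:1, - c:]" .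
  then have nz: "a \<noteq> 0" "p \<noteq> 0" by auto
  have "degree (a * (scale (q\<^sup>2) p * [:1, - 1:])) = degree a + (degree (scale (q\<^sup>2) p) + 1)"
    using nz q_nonzero by (subst degree_mult_eq; simp add: scale_eq_0_iff del: mult_pCons_right)
      (subst degree_mult_eq; simp add: scale_eq_0_iff)
  also have "degree (a * (scale (q\<^sup>2) p * [:1, - 1:])) = 1"
    unfolding eq using c(1) by simp
  finally have "degree a = 0" "degree p = 0"
    using q_nonzero by (simp_all add: degree_scale)
  then obtain \<alpha> \<beta> where ab: "a = [:\<alpha>:]" "p = [:\<beta>:]" by (meson degree_eq_zeroE)
  \<comment> \<open>Compare the constant terms in y.\<close>
  with eq have "\<alpha> * \<beta> = 1" by (simp add: mult.commute)
  then have "\<alpha> \<noteq> 0" "\<beta> = inverse \<alpha>" by (auto simp: inverse_unique)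
  moreover have "cls (\<phi> z) = cls (const \<alpha> * z)"
    using hz ab by (auto simp: cls_eq_iff symbol_const_mult symbol_z homogeneous_def a_def one_pCons)
  moreover have "cls (\<phi> zs) = cls (const \<beta> * zs)"
    using hzs ab b by (auto simp: cls_eq_iff symbol_const_mult symbol_zs homogeneous_def)
  ultimately show ?thesis by metis
qed

end

section \<open>Symmetries of the quantum disc\<close>

lemma uq_simps:
  "carrier (uq q) = carrier (presented_algebra (uq_relations q))"
  "x \<oplus>\<^bsub>uq q\<^esub> y = x \<oplus>\<^bsub>presented_algebra (uq_relations q)\<^esub> y"
  "x \<otimes>\<^bsub>uq q\<^esub> y = x \<otimes>\<^bsub>presented_algebra (uq_relations q)\<^esub> y"
  "\<one>\<^bsub>uq q\<^esub> = \<one>\<^bsub>presented_algebra (uq_relations q)\<^esub>"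
  "c \<odot>\<^bsub>uq q\<^esub> x = c \<odot>\<^bsub>presented_algebra (uq_relations q)\<^esub> x"
  by (simp_all add: uq_def uq_algebra_def module.defs hopf.defs)

lemma tens_single:
  "tens (Poly_Mapping.single u 1) (Poly_Mapping.single v 1) = Poly_Mapping.single (u, v) 1"
  by (simp add: tens_def)

lemma tensor_class_self:
  assumes "Poly_Mapping.keys t \<subseteq> carrier A \<times> carrier A"
  shows "t \<in> tensor_class A t"
proof -
  \<comment> \<open>Finitely supported functions form a complex vector space, which puts 0 into the
    span of the bilinearity relations.\<close>
  interpret Modules.module "\<lambda>c. Poly_Mapping.map ((*) c) :: ('a \<times> 'a \<Rightarrow>\<^sub>0 complex) \<Rightarrow> _"
    by unfold_locales
      (auto intro!: poly_mapping_eqI simp: Poly_Mapping.map.rep_eq lookup_add when_def algebra_simps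
        simp flip: distrib_left)
  show ?thesis
    using assms span_zero by (simp add: tensor_class_def)
qed

text \<open>The coproduct is a set of representing formal sums. Exhibiting the one-term
  representative of k (x) k lets the symmetry axiom be read off for k.\<close>

lemma comult_uq_k: "Poly_Mapping.single (uq_k q, uq_k q) 1 \<in> comult (uq q) (uq_k q)"
proof -
  let ?t = "Poly_Mapping.single (uq_k q, uq_k q) (1 :: complex)"
  have "free_lift const free_comult (var K) = Poly_Mapping.single ([K], [K]) 1"
    by (simp add: free_lift_def var_def tens_single const_def)
  then have "uq_tensor q (free_lift const free_comult (var K)) = ?t"
    by (simp add: uq_tensor_def uq_k_def var_def)
  moreover have "?t \<in> tensor_class (uq_algebra q) ?t"
    by (rule tensor_class_self)
      (simp add: uq_algebra_def carrier_presented_algebra uq_k_def)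
  moreover have "var K \<in> uq_k q"
    unfolding uq_k_def by (rule residue_class_self)
  ultimately show ?thesis
    by (auto simp: uq_def module.defs hopf.defs intro!: bexI[of _ "var K"])
qed

section \<open>The action on representatives\<close>

locale disc_symmetry = qdisc_param +
  fixes \<pi> :: "uqsl2 \<Rightarrow> disc \<Rightarrow> disc"
  assumes symmetry: "\<pi> \<in> disc_symmetries q"
begin

abbreviation ucls :: "(uq_gen list \<Rightarrow>\<^sub>0 complex) \<Rightarrow> uqsl2" where
  "ucls \<equiv> residue_class (uq_relations q)"

lemma carrier_qdisc: "carrier (qdisc q) = range cls"
  by (simp add: qdisc_def carrier_presented_algebra)

lemma ucls_carrier: "ucls h \<in> carrier (uq q)"
  by (simp add: uq_simps carrier_presented_algebra)

lemma pi_algebra_hom: "\<pi> \<in> algebra_hom (uq q) (End_algebra (qdisc q))"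
  using symmetry by (simp add: symmetries_def)

lemma pi_carrier: "\<pi> (ucls h) \<in> carrier (End_algebra (qdisc q))"
  using pi_algebra_hom ucls_carrier by (auto simp: algebra_hom_def ring_hom_def)

text \<open>A chosen representative of the result, so that the action can be computed in the free
  algebra; only the class of \<open>act h x\<close> carries meaning.\<close>

definition act :: "(uq_gen list \<Rightarrow>\<^sub>0 complex) \<Rightarrow> (disc_gen list \<Rightarrow>\<^sub>0 complex) \<Rightarrow>
    (disc_gen list \<Rightarrow>\<^sub>0 complex)" where
  "act h x = (SOME x'. \<pi> (ucls h) (cls x) = cls x')"

lemma pi_cls: "\<pi> (ucls h) (cls x) = cls (act h x)"
proof -
  have "\<pi> (ucls h) (cls x) \<in> carrier (qdisc q)"
    using pi_carrier[of h] by (auto simp: End_algebra_def carrier_qdisc)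
  then have "\<exists>x'. \<pi> (ucls h) (cls x) = cls x'"
    by (auto simp: carrier_qdisc)
  then show ?thesis unfolding act_def by (rule someI_ex)
qed

lemma act_cong: "ucls g = ucls h \<Longrightarrow> cls x = cls y \<Longrightarrow> cls (act g x) = cls (act h y)"
  by (simp flip: pi_cls)

lemma act_add: "cls (act h (x + y)) = cls (act h x + act h y)"
proof -
  have "\<pi> (ucls h) (cls x \<oplus>\<^bsub>qdisc q\<^esub> cls y) =
      \<pi> (ucls h) (cls x) \<oplus>\<^bsub>qdisc q\<^esub> \<pi> (ucls h) (cls y)"
    using pi_carrier[of h] by (auto simp: End_algebra_def carrier_qdisc)
  then show ?thesis by (simp add: pi_cls qdisc_def add_presented_algebra)
qed

lemma act_const_mult: "cls (act h (const c * x)) = cls (const c * act h x)"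
proof -
  have "\<pi> (ucls h) (c \<odot>\<^bsub>qdisc q\<^esub> cls x) = c \<odot>\<^bsub>qdisc q\<^esub> \<pi> (ucls h) (cls x)"
    using pi_carrier[of h] by (auto simp: End_algebra_def carrier_qdisc)
  then show ?thesis by (simp add: pi_cls qdisc_def smult_presented_algebra)
qed

lemma act_add_left: "cls (act (g + h) x) = cls (act g x + act h x)"
proof -
  have "\<pi> (ucls g \<oplus>\<^bsub>uq q\<^esub> ucls h) = \<pi> (ucls g) \<oplus>\<^bsub>End_algebra (qdisc q)\<^esub> \<pi> (ucls h)"
    using pi_algebra_hom ucls_carrier by (auto simp: algebra_hom_def ring_hom_def)
  then have "\<pi> (ucls (g + h)) (cls x) = \<pi> (ucls g) (cls x) \<oplus>\<^bsub>qdisc q\<^esub> \<pi> (ucls h) (cls x)"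
    by (simp add: uq_simps add_presented_algebra End_algebra_def carrier_qdisc)
  then show ?thesis by (simp add: pi_cls qdisc_def add_presented_algebra)
qed

lemma act_const_mult_left: "cls (act (const c * h) x) = cls (const c * act h x)"
proof -
  have "\<pi> (c \<odot>\<^bsub>uq q\<^esub> ucls h) = c \<odot>\<^bsub>End_algebra (qdisc q)\<^esub> \<pi> (ucls h)"
    using pi_algebra_hom ucls_carrier by (auto simp: algebra_hom_def)
  then have "\<pi> (ucls (const c * h)) (cls x) = c \<odot>\<^bsub>qdisc q\<^esub> \<pi> (ucls h) (cls x)"
    by (simp add: uq_simps smult_presented_algebra End_algebra_def carrier_qdisc)
  then show ?thesis by (simp add: pi_cls qdisc_def smult_presented_algebra)
qed

lemma act_diff_left: "cls (act (g - h) x) = cls (act g x - act h x)"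
  using act_add_left[of g "const (- 1) * h" x]
    residue_class_add[OF refl act_const_mult_left[of "- 1" h x], of "act g x"]
  by (simp add: const_simps)

lemma act_mult_left: "cls (act (g * h) x) = cls (act g (act h x))"
proof -
  have "\<pi> (ucls g \<otimes>\<^bsub>uq q\<^esub> ucls h) = \<pi> (ucls g) \<otimes>\<^bsub>End_algebra (qdisc q)\<^esub> \<pi> (ucls h)"
    using pi_algebra_hom ucls_carrier by (auto simp: algebra_hom_def ring_hom_def)
  then have "\<pi> (ucls (g * h)) (cls x) = \<pi> (ucls g) (\<pi> (ucls h) (cls x))"
    by (simp add: uq_simps mult_presented_algebra End_algebra_def carrier_qdisc compose_def)
  then show ?thesis by (simp add: pi_cls)
qed

lemma act_1: "cls (act 1 x) = cls x"
proof -
  have "\<pi> \<one>\<^bsub>uq q\<^esub> = \<one>\<^bsub>End_algebra (qdisc q)\<^esub>"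
    using pi_algebra_hom by (auto simp: algebra_hom_def ring_hom_def)
  then have "\<pi> (ucls 1) (cls x) = cls x"
    by (simp add: uq_simps one_presented_algebra End_algebra_def carrier_qdisc)
  then show ?thesis by (simp add: pi_cls)
qed

text \<open>As k is group-like, the sum over its coproduct has a single term with coefficient
  1.\<close>

lemma act_k_mult: "cls (act (var K) (x * y)) = cls (act (var K) x * act (var K) y)"
proof -
  interpret A: abelian_monoid "qdisc q"
    unfolding qdisc_def by (rule abelian_monoid_presented_algebra)
  have "\<forall>t\<in>comult (uq q) (uq_k q). \<pi> (uq_k q) (cls x \<otimes>\<^bsub>qdisc q\<^esub> cls y) =
      (\<Oplus>\<^bsub>qdisc q\<^esub>p\<in>Poly_Mapping.keys t. Poly_Mapping.lookup t p \<odot>\<^bsub>qdisc q\<^esub>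
        (\<pi> (fst p) (cls x) \<otimes>\<^bsub>qdisc q\<^esub> \<pi> (snd p) (cls y)))"
    using symmetry ucls_carrier[of "var K"]
    by (simp add: symmetries_def carrier_qdisc uq_k_def)
  from bspec[OF this comult_uq_k]
  have "\<pi> (uq_k q) (cls x \<otimes>\<^bsub>qdisc q\<^esub> cls y) =
      (\<Oplus>\<^bsub>qdisc q\<^esub>p\<in>{(uq_k q, uq_k q)}.
        Poly_Mapping.lookup (Poly_Mapping.single (uq_k q, uq_k q) 1) p \<odot>\<^bsub>qdisc q\<^esub>
        (\<pi> (fst p) (cls x) \<otimes>\<^bsub>qdisc q\<^esub> \<pi> (snd p) (cls y)))"
    by simp
  also have "\<dots> = 1 \<odot>\<^bsub>qdisc q\<^esub> (\<pi> (uq_k q) (cls x) \<otimes>\<^bsub>qdisc q\<^esub> \<pi> (uq_k q) (cls y))"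
  proof -
    have "1 \<odot>\<^bsub>qdisc q\<^esub> (\<pi> (uq_k q) (cls x) \<otimes>\<^bsub>qdisc q\<^esub> \<pi> (uq_k q) (cls y)) \<in> carrier (qdisc q)"
      by (simp add: carrier_qdisc pi_cls uq_k_def)
        (simp add: qdisc_def presented_algebra_simps)
    then show ?thesis by (subst A.finsum_insert) auto
  qed
  finally show ?thesis
    by (simp add: uq_k_def pi_cls qdisc_def presented_algebra_simps const_simps)
qed

lemma act_relation:
  assumes "g - h \<in> uq_relations q"
  shows "cls (act g x) = cls (act h x)"
  by (rule act_cong[OF residue_class_eqI[OF assms] refl])

lemma act_ki_k: "cls (act (var Ki) (act (var K) x)) = cls x"
  using act_relation[of "var Ki * var K" 1 x] by (simp add: uq_relations_def act_mult_left act_1)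

lemma act_k_ki: "cls (act (var K) (act (var Ki) x)) = cls x"
  using act_relation[of "var K * var Ki" 1 x] by (simp add: uq_relations_def act_mult_left act_1)

lemma act_k_e: "cls (act (var K) (act (var E) x)) = cls (const (q\<^sup>2) * act (var E) (act (var K) x))"
proof -
  have "cls (act (var K * var E) x) = cls (act (const (q\<^sup>2) * (var E * var K)) x)"
    by (rule act_relation) (simp add: uq_relations_def mult.assoc)
  also have "\<dots> = cls (const (q\<^sup>2) * act (var E * var K) x)" by (rule act_const_mult_left)
  also have "\<dots> = cls (const (q\<^sup>2) * act (var E) (act (var K) x))"
    by (intro residue_class_mult refl act_mult_left)
  finally show ?thesis by (simp add: act_mult_left)
qed

lemma act_k_f:
  "cls (act (var K) (act (var F) x)) = cls (const (inverse (q\<^sup>2)) * act (var F) (act (var K) x))"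
proof -
  have "cls (act (var K * var F) x) = cls (act (const (inverse (q\<^sup>2)) * (var F * var K)) x)"
    by (rule act_relation) (simp add: uq_relations_def mult.assoc)
  also have "\<dots> = cls (const (inverse (q\<^sup>2)) * act (var F * var K) x)" by (rule act_const_mult_left)
  also have "\<dots> = cls (const (inverse (q\<^sup>2)) * act (var F) (act (var K) x))"
    by (intro residue_class_mult refl act_mult_left)
  finally show ?thesis by (simp add: act_mult_left)
qed

section \<open>The generator k acts by an automorphism\<close>

lemma act_k_injective:
  assumes "cls (act (var K) x) = cls (act (var K) y)"
  shows "cls x = cls y"
  using act_cong[OF refl assms, of "var Ki"] by (simp add: act_ki_k)

text \<open>A surjective multiplicative map preserves 1: with e = k(1) and u = k^-1(1) one has e = e
  k(u) = k(1 u) = 1.\<close>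

lemma act_k_1: "cls (act (var K) 1) = cls 1"
proof -
  let ?e = "act (var K) 1" and ?u = "act (var Ki) 1"
  have "cls ?e = cls (?e * act (var K) ?u)"
    using residue_class_mult[OF refl act_k_ki, of ?e 1] by simp
  also have "\<dots> = cls (act (var K) (1 * ?u))" by (rule act_k_mult[symmetric])
  also have "\<dots> = cls 1" by (simp add: act_k_ki)
  finally show ?thesis .
qed

lemma act_k_const: "cls (act (var K) (const c)) = cls (const c)"
  using act_const_mult[of "var K" c 1] residue_class_mult[OF refl act_k_1, of "const c"] by simp

lemma endomorphism_act_k: "endomorphism (act (var K))"
  unfolding endomorphism_def
  by (intro conjI allI impI act_cong[OF refl] act_k_const act_add act_k_mult)

text \<open>Each law holds after applying k, which is injective on classes.\<close>

lemma endomorphism_act_ki: "endomorphism (act (var Ki))"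
  unfolding endomorphism_def
proof (intro conjI allI impI act_cong[OF refl] act_add)
  show "cls (act (var Ki) (const c)) = cls (const c)" for c
    by (rule act_k_injective) (simp add: act_k_ki act_k_const)
  show "cls (act (var Ki) (a * b)) = cls (act (var Ki) a * act (var Ki) b)" for a b
  proof (rule act_k_injective)
    have "cls (act (var K) (act (var Ki) a * act (var Ki) b)) =
        cls (act (var K) (act (var Ki) a) * act (var K) (act (var Ki) b))"
      by (rule act_k_mult)
    also have "\<dots> = cls (a * b)" by (intro residue_class_mult act_k_ki)
    finally show "cls (act (var K) (act (var Ki) (a * b))) =
        cls (act (var K) (act (var Ki) a * act (var Ki) b))"
      by (simp add: act_k_ki)
  qed
qed

section \<open>The weight constant and the eigenspaces of k\<close>

definition weight :: complex where
  "weight = (SOME \<alpha>. \<alpha> \<noteq> 0 \<and> cls (act (var K) z) = cls (const \<alpha> * z) \<and>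
    cls (act (var K) zs) = cls (const (inverse \<alpha>) * zs))"

lemma weight:
  "weight \<noteq> 0" "cls (act (var K) z) = cls (const weight * z)"
  "cls (act (var K) zs) = cls (const (inverse weight) * zs)"
proof -
  have "\<exists>\<alpha>. \<alpha> \<noteq> 0 \<and> cls (act (var K) z) = cls (const \<alpha> * z) \<and>
      cls (act (var K) zs) = cls (const (inverse \<alpha>) * zs)"
    by (rule automorphism_diagonal[OF endomorphism_act_k endomorphism_act_ki act_k_ki])
  from someI_ex[OF this] show "weight \<noteq> 0" "cls (act (var K) z) = cls (const weight * z)"
    "cls (act (var K) zs) = cls (const (inverse weight) * zs)"
    unfolding weight_def[symmetric] by blast+
qed

lemma weight_constant_weight: "weight_constant q \<pi> weight"
  using weight pi_cls[of "var K" z] pi_cls[of "var K" zs]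
  by (simp add: weight_constant_def uq_k_def disc_z_def disc_zs_def qdisc_def
      smult_presented_algebra)

lemma act_k_word:
  "cls (act (var K) (Poly_Mapping.single w 1)) =
   cls (const (weight powi word_degree w) * Poly_Mapping.single w 1)"
proof (induction w)
  case Nil
  then show ?case by (simp add: single_Nil act_k_1 const_simps)
next
  case (Cons g w)
  have g: "cls (act (var K) (var g)) = cls (const (weight powi gen_degree g) * var g)"
    using weight by (cases g) (simp_all add: power_int_minus)
  have "cls (act (var K) (Poly_Mapping.single (g # w) 1)) =
      cls (act (var K) (var g) * act (var K) (Poly_Mapping.single w 1))"
    unfolding single_Cons by (rule act_k_mult)
  also have "\<dots> = cls (const (weight powi gen_degree g) * var g *
      (const (weight powi word_degree w) * Poly_Mapping.single w 1))"
    by (intro residue_class_mult g Cons.IH)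
  also have "\<dots> = cls (const (weight powi word_degree (g # w)) * Poly_Mapping.single (g # w) 1)"
    using weight(1)
    by (simp add: single_Cons mult.assoc const_left_commute[of "var g"] power_int_add const_simps)
  finally show ?case .
qed

lemma symbol_act_k: "symbol q (act (var K) x) k = smult (weight powi k) (symbol q x k)"
proof (induction x rule: poly_mapping_induct)
  case zero
  show ?case
    using symbol_eqI[OF act_k_const[of 0], of k] by (simp add: const_simps)
next
  case (single w c)
  have "cls (act (var K) (Poly_Mapping.single w c)) =
      cls (const c * act (var K) (Poly_Mapping.single w 1))"
    using act_const_mult[of "var K" c "Poly_Mapping.single w 1"]
    by (simp flip: single_conv_const[of w c])
  also have "\<dots> = cls (const c * (const (weight powi word_degree w) * Poly_Mapping.single w 1))"
    by (intro residue_class_mult refl act_k_word)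
  finally show ?case
    by (drule_tac symbol_eqI[where k = k]) (simp add: symbol_const_mult symbol_single mult.commute)
next
  case (add x y)
  then show ?case
    using symbol_eqI[OF act_add[of "var K" x y], of k] by (simp add: symbol_add smult_add_right)
qed

lemma act_k_homogeneous:
  assumes "homogeneous k x"
  shows "cls (act (var K) x) = cls (const (weight powi k) * x)"
  using assms by (auto simp: cls_eq_iff symbol_act_k symbol_const_mult homogeneous_def)

text \<open>An operator that commutes with \<open>k\<close> up to a factor \<open>c\<close> multiplies the eigenvalues of \<open>k\<close> by \<open>c\<close>.\<close>

lemma symbol_act_homogeneous:
  assumes comm: "cls (act (var K) (act h x)) = cls (const c * act h (act (var K) x))"
    and x: "homogeneous k x" and m: "symbol q (act h x) m \<noteq> 0"
  shows "weight powi m = c * weight powi k"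
proof -
  have "cls (act h (act (var K) x)) = cls (act h (const (weight powi k) * x))"
    by (rule act_cong[OF refl act_k_homogeneous[OF x]])
  also have "\<dots> = cls (const (weight powi k) * act h x)" by (rule act_const_mult)
  finally have "cls (act (var K) (act h x)) = cls (const c * (const (weight powi k) * act h x))"
    unfolding comm by (intro residue_class_mult refl)
  from symbol_eqI[OF this, of m]
  have "smult (weight powi m) (symbol q (act h x) m) =
      smult (c * weight powi k) (symbol q (act h x) m)"
    by (simp add: symbol_act_k symbol_const_mult)
  then have "smult (weight powi m - c * weight powi k) (symbol q (act h x) m) = 0"
    by (simp only: smult_diff_left right_minus_eq)
  then show ?thesis using m by simp
qed

text \<open>Words are homogeneous and span the free algebra.\<close>

lemma act_eq_0I:
  assumes "\<And>k x. homogeneous k x \<Longrightarrow> cls (act h x) = cls 0"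
  shows "cls (act h x) = cls 0"
proof (induction x rule: poly_mapping_induct)
  case zero
  show ?case by (rule assms[of 0]) (simp add: homogeneous_def)
next
  case (single w c)
  show ?case by (rule assms[of "word_degree w"]) (simp add: homogeneous_def symbol_single)
next
  case (add x y)
  then show ?case using act_add[of h x y] residue_class_add[OF add] by simp
qed

section \<open>Trivial actions and the shift of degrees\<close>

text \<open>If e and f act by 0, the relation for ef - fe makes k and k^-1 agree on
  \<open>z\<close>, so the weight squares to 1.\<close>

lemma zero_series_of_trivial:
  assumes e: "\<And>x. cls (act (var E) x) = cls 0" and f: "\<And>x. cls (act (var F) x) = cls 0"
  shows "\<pi> \<in> zero_series q"
proof -
  \<comment> \<open>Equality is needed as functions on the whole type; outside the carrier both
    sides are \<open>undefined\<close>.\<close>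
  have zero: "\<pi> (ucls h) = \<zero>\<^bsub>End_algebra (qdisc q)\<^esub>" if "\<And>x. cls (act h x) = cls 0" for h
  proof
    fix u
    have "\<zero>\<^bsub>qdisc q\<^esub> = cls 0" by (simp add: qdisc_def zero_presented_algebra)
    then show "\<pi> (ucls h) u = \<zero>\<^bsub>End_algebra (qdisc q)\<^esub> u"
      using pi_carrier[of h] that
      by (cases "u \<in> carrier (qdisc q)")
        (auto simp: End_algebra_def carrier_qdisc pi_cls PiE_def extensional_def)
  qed
  define d where "d = 1 / (q - inverse q)"
  have "q\<^sup>2 \<noteq> 1" using q_not_root[of 2] by simp
  then have "d \<noteq> 0"
    using q_nonzero by (simp add: d_def field_simps power2_eq_square)
  have ef: "cls (act (var E * var F - var F * var E) z) = cls 0"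
  proof -
    have "cls (act (var E) (act (var F) z) - act (var F) (act (var E) z)) = cls (0 - 0)"
      by (intro residue_class_diff e f)
    moreover have "cls (act (var E * var F - var F * var E) z) =
        cls (act (var E) (act (var F) z) - act (var F) (act (var E) z))"
      unfolding act_diff_left by (intro residue_class_diff act_mult_left)
    ultimately show ?thesis by simp
  qed
  also have "cls (act (var E * var F - var F * var E) z) = cls (act (const d * (var K - var Ki)) z)"
    by (rule act_relation) (simp add: uq_relations_def d_def)
  also have "\<dots> = cls (const d * act (var K - var Ki) z)" by (rule act_const_mult_left)
  also have "\<dots> = cls (const d * (act (var K) z - act (var Ki) z))"
    by (intro residue_class_mult refl act_diff_left)
  finally have "cls (act (var K) z) = cls (act (var Ki) z)"
    using \<open>d \<noteq> 0\<close> by (simp add: cls_eq_iff symbol_const_mult symbol_diff)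
  then have "cls (act (var K) (act (var K) z)) = cls z"
    using act_cong[OF refl, of _ _ "var K"] act_k_ki by metis
  from symbol_eqI[OF this, of 1] have "weight * weight = 1"
    by (simp add: symbol_act_k symbol_z one_pCons)
  then have "weight \<in> {- 1, 1}"
    by (auto simp: square_eq_1_iff)
  then show ?thesis
    using symmetry weight_constant_weight zero[of "var E"] zero[of "var F"] e f
    unfolding zero_series_def uq_e_def uq_f_def by blast
qed

lemma grading_shift:
  assumes "\<pi> \<notin> zero_series q"
  shows "\<exists>!n::int. n \<noteq> 0 \<and>
    (\<forall>k::int. \<pi> (uq_e q) ` disc_grade q k \<subseteq> disc_grade q (k + n) \<and>
              \<pi> (uq_f q) ` disc_grade q k \<subseteq> disc_grade q (k - n))"
proof -
  \<comment> \<open>Homogeneity depends only on the class, so inclusions between graded pieces can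
    be tested on representatives.\<close>
  have sub_iff: "\<pi> (ucls h) ` disc_grade q k \<subseteq> disc_grade q m \<longleftrightarrow>
      (\<forall>x. homogeneous k x \<longrightarrow> homogeneous m (act h x))" for h k m
  proof -
    have "homogeneous m a" if "homogeneous m b" "cls a = cls b" for a b
      using that by (simp add: homogeneous_def cls_eq_iff)
    then show ?thesis
      unfolding disc_grade_eq image_subset_iff
      by (auto simp: pi_cls)
  qed
  define shifts where "shifts n \<longleftrightarrow> (\<forall>k x. homogeneous k x \<longrightarrow>
      homogeneous (k + n) (act (var E) x) \<and> homogeneous (k - n) (act (var F) x))" for n
  have shifts_iff: "(\<forall>k. \<pi> (uq_e q) ` disc_grade q k \<subseteq> disc_grade q (k + n) \<and>
      \<pi> (uq_f q) ` disc_grade q k \<subseteq> disc_grade q (k - n)) \<longleftrightarrow> shifts n" for n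
    unfolding uq_e_def uq_f_def sub_iff shifts_def by blast
  \<comment> \<open>Otherwise no eigenvalue of k is q^2 or q^-2 times another, so e and f kill every
    homogeneous element and the symmetry lies in the excluded series.\<close>
  have "\<exists>n. weight powi n = q\<^sup>2"
  proof (rule ccontr)
    assume no: "\<nexists>n. weight powi n = q\<^sup>2"
    have e: "cls (act (var E) x) = cls 0" for x
    proof (rule act_eq_0I)
      fix k x assume x: "homogeneous k x"
      have "symbol q (act (var E) x) m = 0" for m
      proof (rule ccontr)
        assume "symbol q (act (var E) x) m \<noteq> 0"
        then have "weight powi m = q\<^sup>2 * weight powi k"
          by (rule symbol_act_homogeneous[OF act_k_e x])
        then have "weight powi (m - k) = q\<^sup>2"
          using weight(1) by (simp add: power_int_diff)
        then show False using no by blast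
      qed
      then show "cls (act (var E) x) = cls 0" by (simp add: cls_eq_iff)
    qed
    have f: "cls (act (var F) x) = cls 0" for x
    proof (rule act_eq_0I)
      fix k x assume x: "homogeneous k x"
      have "symbol q (act (var F) x) m = 0" for m
      proof (rule ccontr)
        assume "symbol q (act (var F) x) m \<noteq> 0"
        then have "weight powi m = inverse (q\<^sup>2) * weight powi k"
          by (rule symbol_act_homogeneous[OF act_k_f x])
        then have "weight powi (k - m) = q\<^sup>2"
          using weight(1) q_nonzero by (simp add: power_int_diff field_simps)
        then show False using no by blast
      qed
      then show "cls (act (var F) x) = cls 0" by (simp add: cls_eq_iff)
    qed
    show False using zero_series_of_trivial[OF e f] assms by blast
  qed
  then obtain n where n: "weight powi n = q\<^sup>2" by blast
  \<comment> \<open>Raising weight^(a - b) = 1 to the power \<open>n\<close> gives q^(2(a - b)) = 1.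
    Hence distinct degrees have distinct eigenvalues.\<close>
  have inj: "a = b" if "weight powi a = weight powi b" for a b
  proof -
    have "weight powi (a - b) = 1"
      using that weight(1) by (simp add: power_int_diff)
    then have "weight powi (n * (a - b)) = 1"
      by (metis mult.commute power_int_mult power_int_1_left)
    then have "q powi (2 * (a - b)) = 1"
      unfolding power_int_mult using n by (simp add: power_int_mult)
    then show ?thesis by (simp add: q_powi_eq_1_iff)
  qed
  have "n \<noteq> 0"
    using n q_not_root[of 2] by auto
  moreover have "shifts n"
    unfolding shifts_def
  proof (intro allI impI)
    fix k x assume x: "homogeneous k x"
    have "homogeneous (k + n) (act (var E) x)"
      unfolding homogeneous_def
    proof (intro allI impI, rule ccontr)
      fix m assume "m \<noteq> k + n" "symbol q (act (var E) x) m \<noteq> 0"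
      then have "weight powi m = weight powi (k + n)"
        using symbol_act_homogeneous[OF act_k_e x] weight(1) by (simp add: power_int_add n)
      then show False using inj \<open>m \<noteq> k + n\<close> by blast
    qed
    moreover have "homogeneous (k - n) (act (var F) x)"
      unfolding homogeneous_def
    proof (intro allI impI, rule ccontr)
      fix m assume "m \<noteq> k - n" "symbol q (act (var F) x) m \<noteq> 0"
      then have "weight powi m = weight powi (k - n)"
        using symbol_act_homogeneous[OF act_k_f x] weight(1)
        by (simp add: power_int_diff n field_simps)
      then show False using inj \<open>m \<noteq> k - n\<close> by blast
    qed
    ultimately show "homogeneous (k + n) (act (var E) x) \<and> homogeneous (k - n) (act (var F) x)" ..
  qed
  \<comment> \<open>With two different shifts every image would be homogeneous of two different
    degrees, hence 0, and the action would be trivial.\<close>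
  moreover have "n' = n" if n': "shifts n'" for n'
  proof (rule ccontr)
    assume "n' \<noteq> n"
    have zero: "cls a = cls 0" if "homogeneous k a" "homogeneous l a" "k \<noteq> l" for k l a
      using that by (auto simp: cls_eq_iff homogeneous_def)
    have "cls (act (var E) x) = cls 0" for x
    proof (rule act_eq_0I)
      fix k x assume "homogeneous k x"
      then show "cls (act (var E) x) = cls 0"
        using \<open>shifts n\<close> n' \<open>n' \<noteq> n\<close> unfolding shifts_def by (intro zero[of "k + n" _ "k + n'"]) auto
    qed
    moreover have "cls (act (var F) x) = cls 0" for x
    proof (rule act_eq_0I)
      fix k x assume "homogeneous k x"
      then show "cls (act (var F) x) = cls 0"
        using \<open>shifts n\<close> n' \<open>n' \<noteq> n\<close> unfolding shifts_def by (intro zero[of "k - n" _ "k - n'"]) auto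
    qed
    ultimately show False using zero_series_of_trivial assms by blast
  qed
  ultimately show ?thesis
    unfolding shifts_iff by blast
qed

end

theorem proposition3p3:
  fixes q :: complex
  assumes "q \<noteq> 0"
    and "\<And>m::nat. m > 0 \<Longrightarrow> q ^ m \<noteq> 1"
    and "\<pi> \<in> disc_symmetries q"
    and "\<pi> \<notin> zero_series q"
  shows "\<exists>!n::int. n \<noteq> 0 \<and>
    (\<forall>k::int. \<pi> (uq_e q) ` disc_grade q k \<subseteq> disc_grade q (k + n) \<and>
              \<pi> (uq_f q) ` disc_grade q k \<subseteq> disc_grade q (k - n))"
proof -
  interpret disc_symmetry q \<pi>
    by unfold_locales (fact assms)+
  show ?thesis by (rule grading_shift) fact
qed

end
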